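(* Let $\mathcal{L}$ be a Lindbladian on density operators on $\mathbb{C}^d$ with a unique steady state $\sigma$, i.e. $\{\rho : \mathcal{L}(\rho)=0\}=\{\sigma\}$. If $\sigma$ has an eigenvalue $\lambda<1/d^2$, then $\gamma(\mathcal{L})>0$.
   Context: A Lindbladian has GKSL form and generates the CPTP semigroup $(e^{t\mathcal{L}})_{t\ge0}$. For a program space $\mathcal{H}_P$, program states $(\pi_t)_{t\ge0}$ on $\mathcal{H}_P$ and $T\ge0$, the exact programming cost is $\gamma(\pi_t,\mathcal{L},T)=\log_2\min\{\|\mathcal{P}\|_\diamond : \mathcal{P}$ Hermitian-preserving trace-preserving linear map from operators on $\mathbb{C}^d\otimes\mathcal{H}_P$ to operators on $\mathbb{C}^d$ with $\mathcal{P}(\cdot\otimes\pi_t)=e^{t\mathcal{L}}$ for all $t\in[0,T]\}$ (the minimum over an empty set being $+\infty$), where $\|\cdot\|_\diamond$ is the diamond norm, and $\gamma(\pi_t,\mathcal{L})=\lim_{T\to\infty}\gamma(\pi_t,\mathcal{L},T)$. The quantity $\gamma(\mathcal{L})$ denotes $\gamma(\pi_t,\mathcal{L})$ for the Choi-state program states $\pi_t=J(e^{t\mathcal{L}})/d$ on $\mathcal{H}_P=\mathbb{C}^d\otimes\mathbb{C}^d$, where $J(\mathcal{N})=\sum_{i,j=0}^{d-1}|i\rangle\langle j|\otimes\mathcal{N}(|i\rangle\langle j|)$. *)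

theory Defs
  imports "HOL-Analysis.Analysis"
begin

text \<open>Operators on a finite-dimensional Hilbert space with orthonormal basis indexed
by a finite type 'a are represented as complex matrices of type complex^'a^'a.
C^d corresponds to a finite type 'n with d = CARD('n); tensor products of spaces
correspond to product index types.\<close>

definition adj :: "complex^'n^'m \<Rightarrow> complex^'m^'n" where
  "adj A = (\<chi> i j. cnj (A$j$i))"

definition mtrace :: "complex^'n^'n \<Rightarrow> complex" where
  "mtrace A = (\<Sum>i\<in>UNIV. A$i$i)"

definition cscale :: "complex \<Rightarrow> complex^'n^'m \<Rightarrow> complex^'n^'m" where
  "cscale c A = (\<chi> i j. c * A$i$j)"

definition hermitian :: "complex^'n^'n \<Rightarrow> bool" where
  "hermitian A \<longleftrightarrow> adj A = A"

definition qform :: "complex^'n^'n \<Rightarrow> complex^'n \<Rightarrow> complex" where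
  "qform A v = (\<Sum>i\<in>UNIV. \<Sum>j\<in>UNIV. cnj (v$i) * A$i$j * v$j)"

definition psd :: "complex^'n^'n \<Rightarrow> bool" where
  "psd A \<longleftrightarrow> hermitian A \<and> (\<forall>v. Im (qform A v) = 0 \<and> 0 \<le> Re (qform A v))"

definition density :: "complex^'n^'n \<Rightarrow> bool" where
  "density \<rho> \<longleftrightarrow> psd \<rho> \<and> mtrace \<rho> = 1"

definition mat_abs :: "complex^'n^'n \<Rightarrow> complex^'n^'n" where
  "mat_abs A = (THE P. psd P \<and> P ** P = adj A ** A)"

definition trace_norm :: "complex^'n^'n \<Rightarrow> real" where
  "trace_norm A = Re (mtrace (mat_abs A))"

definition gksl :: "complex^'n^'n \<Rightarrow> (complex^'n^'n) list \<Rightarrow> complex^'n^'n \<Rightarrow> complex^'n^'n" where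
  "gksl H Ls \<rho> = cscale (-\<i>) (H ** \<rho> - \<rho> ** H)
     + sum_list (map (\<lambda>K. K ** \<rho> ** adj K - cscale (1/2) (adj K ** K ** \<rho> + \<rho> ** (adj K ** K))) Ls)"

definition is_lindbladian :: "(complex^'n^'n \<Rightarrow> complex^'n^'n) \<Rightarrow> bool" where
  "is_lindbladian L \<longleftrightarrow> (\<exists>H Ls. hermitian H \<and> L = gksl H Ls)"

definition semigroup :: "(complex^'n^'n \<Rightarrow> complex^'n^'n) \<Rightarrow> real \<Rightarrow> complex^'n^'n \<Rightarrow> complex^'n^'n" where
  "semigroup L t X = (\<Sum>k. (t ^ k / fact k) *\<^sub>R (L ^^ k) X)"

definition tensor :: "complex^'a^'a \<Rightarrow> complex^'b^'b \<Rightarrow> complex^('a \<times> 'b)^('a \<times> 'b)" where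
  "tensor A B = (\<chi> ip jq. A$(fst ip)$(fst jq) * B$(snd ip)$(snd jq))"

definition ketbra :: "'n \<Rightarrow> 'n \<Rightarrow> complex^'n^'n" where
  "ketbra i j = (\<chi> a b. if a = i \<and> b = j then 1 else 0)"

text \<open>Choi operator J(N) = sum_{ij} |i><j| (x) N(|i><j|).\<close>
definition choi :: "(complex^'n^'n \<Rightarrow> complex^'m^'m) \<Rightarrow> complex^('n \<times> 'm)^('n \<times> 'm)" where
  "choi N = (\<chi> ia jb. N (ketbra (fst ia) (fst jb)) $ snd ia $ snd jb)"

definition choi_state :: "(complex^'n^'n \<Rightarrow> complex^'n^'n) \<Rightarrow> real \<Rightarrow> complex^('n \<times> 'n)^('n \<times> 'n)" where
  "choi_state L t = cscale (1 / of_nat CARD('n)) (choi (semigroup L t))"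

definition tensor_id :: "(complex^'a^'a \<Rightarrow> complex^'b^'b) \<Rightarrow> complex^('a \<times> 'c::finite)^('a \<times> 'c)
    \<Rightarrow> complex^('b \<times> 'c)^('b \<times> 'c)" where
  "tensor_id \<Phi> X = (\<chi> bk bl. \<Phi> (\<chi> i j. X$(i, snd bk)$(j, snd bl)) $ fst bk $ fst bl)"

definition diamond_norm :: "(complex^'a^'a \<Rightarrow> complex^'b^'b) \<Rightarrow> real" where
  "diamond_norm \<Phi> = (SUP X\<in>{X :: complex^('a \<times> 'a)^('a \<times> 'a). trace_norm X \<le> 1}.
                         trace_norm (tensor_id \<Phi> X))"

definition hp_tp_linear :: "(complex^'a^'a \<Rightarrow> complex^'b^'b) \<Rightarrow> bool" where
  "hp_tp_linear P \<longleftrightarrow> (\<forall>X Y. P (X + Y) = P X + P Y) \<and> (\<forall>c X. P (cscale c X) = cscale c (P X))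
     \<and> (\<forall>X. P (adj X) = adj (P X)) \<and> (\<forall>X. mtrace (P X) = mtrace X)"

definition prog_cost_T :: "(real \<Rightarrow> complex^'p^'p) \<Rightarrow> (complex^'n^'n \<Rightarrow> complex^'n^'n) \<Rightarrow> real \<Rightarrow> ereal" where
  "prog_cost_T \<pi> L T =
    (let S = {P :: complex^('n \<times> 'p)^('n \<times> 'p) \<Rightarrow> complex^'n^'n.
               hp_tp_linear P \<and> (\<forall>t\<in>{0..T}. \<forall>X. P (tensor X (\<pi> t)) = semigroup L t X)}
     in if S = {} then \<infinity> else ereal (log 2 (INF P\<in>S. diamond_norm P)))"

definition prog_cost :: "(real \<Rightarrow> complex^'p^'p) \<Rightarrow> (complex^'n^'n \<Rightarrow> complex^'n^'n) \<Rightarrow> ereal" where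
  "prog_cost \<pi> L = Lim at_top (prog_cost_T \<pi> L)"

definition gamma :: "(complex^'n^'n \<Rightarrow> complex^'n^'n) \<Rightarrow> ereal" where
  "gamma L = prog_cost (choi_state L) L"

end

theory Submission
  imports Defs "HOL-Complex_Analysis.Cauchy_Integral_Formula"
begin

text \<open>Both sides of the programming constraint \<open>P (X \<otimes> \<pi>\<^sub>t) = exp (t L) X\<close> are entire in \<open>t\<close> and
  linear in \<open>exp (t L)\<close>, so on any nontrivial time interval it amounts to
  \<open>P (X \<otimes> J(N)/d) = N X\<close> for every polynomial \<open>N\<close> in \<open>L\<close>. Uniqueness of the steady state makes
  \<open>ker L\<close> one-dimensional, and since \<open>L\<close> annihilates the trace the map \<open>X \<mapsto> tr X \<sigma>\<close> is such a
  polynomial; another one is the identity. Hence \<open>P (X \<otimes> \<phi>) = X\<close> for the maximally entangled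
  state \<open>\<phi>\<close> and \<open>P (X \<otimes> (1/d \<otimes> \<sigma>)) = tr X \<sigma>\<close>.

  For a unit eigenvector \<open>v\<close> and a positive \<open>P\<close>, the functional
  \<open>Y \<mapsto> tr ((1 - |v><v|) P (|v><v| \<otimes> Y))\<close> is an effect that vanishes at \<open>\<phi>\<close>, so it is at most
  \<open>tr ((1 - \<phi>) Y)\<close>. At \<open>Y = 1/d \<otimes> \<sigma>\<close> this reads \<open>1 - \<lambda> \<le> 1 - 1/d\<^sup>2\<close>. A Hermitian- and
  trace-preserving \<open>P\<close> of diamond norm \<open>1 + \<epsilon>\<close> is positive up to \<open>O(\<epsilon>)\<close>, and the inequality
  survives with an error that vanishes as \<open>\<epsilon> \<rightarrow> 0\<close>. Thus \<open>\<lambda> < 1/d\<^sup>2\<close> keeps the diamond norm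
  away from 1.\<close>

section \<open>Diagonalisation of Hermitian matrices\<close>

definition cip :: "complex^'n \<Rightarrow> complex^'n \<Rightarrow> complex" where
  "cip x y = (\<Sum>i\<in>UNIV. cnj (x$i) * y$i)"

definition diag_mat :: "('n \<Rightarrow> real) \<Rightarrow> complex^'n^'n" where
  "diag_mat d = (\<chi> i j. if i = j then of_real (d i) else 0)"

lemma adj_nth [simp]: "adj A $ i $ j = cnj (A $ j $ i)"
  by (simp add: adj_def)

lemma cscale_nth [simp]: "cscale c A $ i $ j = c * A $ i $ j"
  by (simp add: cscale_def)

lemma diag_mat_nth [simp]: "diag_mat d $ i $ j = (if i = j then of_real (d i) else 0)"
  by (simp add: diag_mat_def)

lemma matrix_mult_nth: "(A ** B) $ i $ j = (\<Sum>k\<in>UNIV. A $ i $ k * B $ k $ j)"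
  by (simp add: matrix_matrix_mult_def)

lemma matrix_vector_nth: "(A *v x) $ i = (\<Sum>j\<in>UNIV. A $ i $ j * x $ j)"
  by (simp add: matrix_vector_mult_def)

lemma adj_adj [simp]: "adj (adj A) = A"
  by (simp add: vec_eq_iff)

lemma adj_add: "adj (A + B) = adj A + adj B"
  by (simp add: vec_eq_iff)

lemma adj_diff: "adj (A - B) = adj A - adj B"
  by (simp add: vec_eq_iff)

lemma adj_mult: "adj (A ** B) = adj B ** adj A"
  by (simp add: vec_eq_iff matrix_mult_nth mult.commute)

lemma adj_diag_mat [simp]: "adj (diag_mat d) = diag_mat d"
  by (simp add: vec_eq_iff)

lemma cip_add_right: "cip x (y + z) = cip x y + cip x z"
  by (simp add: cip_def algebra_simps sum.distrib)

lemma cip_add_left: "cip (x + y) z = cip x z + cip y z"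
  by (simp add: cip_def algebra_simps sum.distrib)

lemma cip_diff_right: "cip x (y - z) = cip x y - cip x z"
  by (simp add: cip_def algebra_simps sum_subtractf)

lemma cip_smult_right: "cip x (c *s y) = c * cip x y"
  by (simp add: cip_def sum_distrib_left algebra_simps)

lemma cip_smult_left: "cip (c *s x) y = cnj c * cip x y"
  by (simp add: cip_def sum_distrib_left algebra_simps)

lemma cip_zero [simp]: "cip x 0 = 0" "cip 0 x = 0"
  by (simp_all add: cip_def)

lemma cnj_cip: "cnj (cip x y) = cip y x"
  by (simp add: cip_def mult.commute)

lemma cip_adj: "cip x (A *v y) = cip (adj A *v x) y"
  unfolding cip_def matrix_vector_nth
  by (simp add: sum_distrib_left sum_distrib_right, subst sum.swap, simp add: algebra_simps)

lemma norm_vec_sq: fixes x :: "complex^'n"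
  shows "(norm x)\<^sup>2 = (\<Sum>i\<in>UNIV. (cmod (x$i))\<^sup>2)"
  by (simp add: norm_vec_def L2_set_def sum_nonneg)

lemma norm_mat_sq: fixes A :: "complex^'n^'m"
  shows "(norm A)\<^sup>2 = (\<Sum>i\<in>UNIV. \<Sum>j\<in>UNIV. (cmod (A$i$j))\<^sup>2)"
proof -
  have "(norm A)\<^sup>2 = (\<Sum>i\<in>UNIV. (norm (A$i))\<^sup>2)"
    by (simp add: norm_vec_def[of A] L2_set_def sum_nonneg)
  then show ?thesis by (simp add: norm_vec_sq)
qed

lemma cip_self: "cip x x = of_real ((norm x)\<^sup>2)"
  by (simp add: norm_vec_sq cip_def complex_norm_square mult.commute del: of_real_power)

lemma qform_cip: "qform A v = cip v (A *v v)"
  by (simp add: qform_def cip_def matrix_vector_nth sum_distrib_left algebra_simps)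

lemma scaleR_smult: "r *\<^sub>R (x :: complex^'n) = complex_of_real r *s x"
  by (simp add: vec_eq_iff complex_eq_iff)

lemma continuous_on_cip [continuous_intros]:
  "continuous_on S f \<Longrightarrow> continuous_on S g \<Longrightarrow> continuous_on S (\<lambda>x. cip (f x) (g x))"
  unfolding cip_def by (intro continuous_intros)

lemma Im_qform_hermitian:
  assumes "hermitian A" shows "Im (cip v (A *v v)) = 0"
proof -
  have "cnj (cip v (A *v v)) = cip v (A *v v)"
    using assms by (simp add: cnj_cip cip_adj[of v A] hermitian_def)
  then show ?thesis by (metis Im_complex_of_real Reals_cnj_iff Reals_cases)
qed

text \<open>The conditions for \<open>i\<close> in \<open>S\<close> are the rows of a square matrix.
  An index outside \<open>S\<close> leaves a zero row, so the matrix is singular, and a normalised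
  kernel vector does the job.\<close>

lemma ex_orthogonal:
  fixes e :: "'n \<Rightarrow> complex^'n"
  assumes "S \<noteq> UNIV"
  shows "\<exists>w. norm w = 1 \<and> (\<forall>i\<in>S. cip (e i) w = 0)"
proof -
  from assms obtain k where k: "k \<notin> S" by auto
  define M :: "complex^'n^'n" where "M = (\<chi> i j. if i \<in> S then cnj (e i $ j) else 0)"
  have "row k M = 0" using k by (simp add: M_def row_def vec_eq_iff)
  then have "det M = 0" by (rule det_zero_row(2))
  then have "\<not> invertible M" by (simp add: invertible_det_nz)
  then have "\<not> (\<exists>B. B ** M = mat 1)" by (simp add: invertible_left_inverse)
  then obtain w where w: "M *v w = 0" "w \<noteq> 0" using matrix_left_invertible_ker[of M] by blast
  have c: "cip (e i) w = 0" if "i \<in> S" for i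
  proof -
    have "(M *v w) $ i = 0" using w by simp
    then show ?thesis using that by (simp add: M_def matrix_vector_nth cip_def)
  qed
  have "norm ((1 / norm w) *\<^sub>R w) = 1" using w by simp
  moreover have "\<forall>i\<in>S. cip (e i) ((1 / norm w) *\<^sub>R w) = 0"
    unfolding scaleR_smult cip_smult_right using c by simp
  ultimately show ?thesis by blast
qed

text \<open>First-order optimality: if \<open>a\<close> were positive, a small negative
  \<open>t\<close> would let the linear term beat the quadratic one.\<close>

lemma linear_quadratic_nonneg:
  fixes a b :: real
  assumes "a \<ge> 0" and "\<And>t. 0 \<le> 2 * t * a + t\<^sup>2 * b"
  shows "a = 0"
proof (rule ccontr)
  assume "a \<noteq> 0"
  then have a: "a > 0" using assms by simp
  define t where "t = - a / (\<bar>b\<bar> + 1)"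
  have "0 \<le> 2 * t * a + t\<^sup>2 * b" by (rule assms)
  also have "\<dots> \<le> 2 * t * a + t\<^sup>2 * (\<bar>b\<bar> + 1)"
    by (intro add_left_mono mult_left_mono) auto
  also have "\<dots> = - a\<^sup>2 / (\<bar>b\<bar> + 1)"
  proof -
    have "c > 0 \<Longrightarrow> 2 * (- a / c) * a + (- a / c)\<^sup>2 * c = - a\<^sup>2 / c" for c :: real
      by (simp add: field_simps power2_eq_square)
    from this[of "\<bar>b\<bar> + 1"] show ?thesis by (simp add: t_def)
  qed
  also have "\<dots> < 0" using a by (simp add: divide_neg_pos)
  finally show False by simp
qed

text \<open>A maximiser \<open>w\<close> of the Rayleigh quotient on the unit sphere of the
  orthogonal complement of the \<open>e i\<close> is an eigenvector: with its maximum \<mu>, the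
  form of \<mu> - A is nonnegative on the complement and vanishes at \<open>w\<close>, which forces
  \<open>w\<close> into the kernel of \<mu> - A.\<close>

lemma hermitian_ex_eigenvector_orthogonal:
  fixes A :: "complex^'n^'n" and e :: "'n \<Rightarrow> complex^'n"
  assumes A: "hermitian A" and S: "S \<noteq> UNIV"
    and e: "\<forall>i\<in>S. A *v e i = of_real (l i) *s e i"
  shows "\<exists>w \<mu>. norm w = 1 \<and> (\<forall>i\<in>S. cip (e i) w = 0) \<and> A *v w = of_real \<mu> *s w"
proof -
  define V where "V = {w. \<forall>i\<in>S. cip (e i) w = 0}"
  define K where "K = sphere 0 1 \<inter> V"
  have "closed V"
  proof -
    have "V = (\<Inter>i\<in>S. {w. cip (e i) w = 0})" by (auto simp: V_def)
    then show ?thesis by (auto intro!: closed_INT closed_Collect_eq continuous_intros)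
  qed
  then have "compact K" unfolding K_def by (intro compact_Int_closed) auto
  moreover have "K \<noteq> {}" using ex_orthogonal[OF S, of e] by (auto simp: K_def V_def)
  moreover have "continuous_on K (\<lambda>w. Re (cip w (A *v w)))"
    by (intro continuous_intros)
  ultimately obtain w where w: "w \<in> K" and max: "\<And>x. x \<in> K \<Longrightarrow> Re (cip x (A *v x)) \<le> Re (cip w (A *v w))"
    using continuous_attains_sup[of K "\<lambda>w. Re (cip w (A *v w))"] by blast
  define \<mu> where "\<mu> = Re (cip w (A *v w))"
  have wV: "w \<in> V" and nw: "norm w = 1" using w by (auto simp: K_def)
  have ub: "Re (cip x (A *v x)) \<le> \<mu> * (norm x)\<^sup>2" if x: "x \<in> V" for x
  proof (cases "x = 0")
    case False
    define y where "y = complex_of_real (1 / norm x) *s x"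
    have "y = (1 / norm x) *\<^sub>R x" by (simp only: y_def scaleR_smult)
    then have "norm y = 1" using False by simp
    moreover have "y \<in> V" using x by (simp add: V_def y_def cip_smult_right)
    ultimately have "y \<in> K" by (simp add: K_def)
    from max[OF this] have "Re (cip y (A *v y)) \<le> \<mu>" by (simp add: \<mu>_def)
    moreover have "Re (cip y (A *v y)) = Re (cip x (A *v x)) / (norm x)\<^sup>2"
      by (simp add: y_def vector_scalar_commute cip_smult_right cip_smult_left power2_eq_square)
    ultimately show ?thesis using False by (simp add: field_simps)
  qed auto
  define b where "b x = of_real \<mu> *s x - A *v x" for x
  have b_add: "b (x + y) = b x + b y" for x y
    by (simp add: b_def matrix_vector_right_distrib vec_eq_iff algebra_simps)
  have b_sm: "b (c *s x) = c *s b x" for c x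
    by (simp add: b_def vector_scalar_commute vec_eq_iff algebra_simps)
  have b_pos: "0 \<le> Re (cip x (b x))" if "x \<in> V" for x
    using ub[OF that] by (simp add: b_def cip_diff_right cip_smult_right cip_self del: of_real_power)
  have b_sym: "cip x (b y) = cip (b x) y" for x y
  proof -
    have "cip (b x) y = cnj (cip y (b x))" by (simp add: cnj_cip)
    also have "\<dots> = cip x (b y)" 
      using A by (simp add: b_def cip_diff_right cip_smult_right cnj_cip cip_adj[of _ A] hermitian_def)
    finally show ?thesis by simp
  qed
  \<comment> \<open>The complement is invariant because the \<open>e i\<close> are eigenvectors of a
    Hermitian matrix; hence \<open>b w\<close> is an admissible direction of variation.\<close>
  have bV: "b w \<in> V"
  proof -
    have "cip (e i) (b w) = 0" if "i \<in> S" for i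
      using that wV e A
      by (simp add: b_def cip_diff_right cip_smult_right V_def cip_adj[of _ A] hermitian_def cip_smult_left)
    then show ?thesis by (simp add: V_def)
  qed
  have w0: "Re (cip w (b w)) = 0"
    using nw by (simp add: b_def cip_diff_right cip_smult_right cip_self \<mu>_def)
  \<comment> \<open>Moving from \<open>w\<close> in the direction \<open>b w\<close>, the linear
    coefficient of the nonnegative form is twice the squared norm of \<open>b w\<close>.\<close>
  have "(norm (b w))\<^sup>2 = 0"
  proof (rule linear_quadratic_nonneg[where b = "Re (cip (b w) (b (b w)))"])
    fix t :: real
    let ?x = "w + of_real t *s b w"
    have "?x \<in> V" using wV bV by (simp add: V_def cip_add_right cip_smult_right)
    from b_pos[OF this]
    have "0 \<le> Re (cip w (b w)) + t * Re (cip w (b (b w))) + t * Re (cip (b w) (b w)) + t\<^sup>2 * Re (cip (b w) (b (b w)))"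
      by (simp add: b_add b_sm cip_add_right cip_add_left cip_smult_right cip_smult_left power2_eq_square algebra_simps)
    then show "0 \<le> 2 * t * (norm (b w))\<^sup>2 + t\<^sup>2 * Re (cip (b w) (b (b w)))"
      using w0 by (simp add: b_sym[of w "b w"] cip_self del: of_real_power)
  qed simp
  then have "b w = 0" by simp
  then have "A *v w = of_real \<mu> *s w" by (simp add: b_def)
  then show ?thesis using wV nw by (auto simp: V_def)
qed

text \<open>Induction over the index set: each step adds a unit eigenvector orthogonal to those
  already found.\<close>

lemma hermitian_orthonormal_eigenvectors:
  fixes A :: "complex^'n^'n"
  assumes A: "hermitian A"
  shows "\<exists>(e :: 'n \<Rightarrow> complex^'n) l. \<forall>i. A *v e i = of_real (l i) *s e i \<and> (\<forall>j. cip (e i) (e j) = (if i = j then 1 else 0))"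
proof -
  have "\<exists>(e :: 'n \<Rightarrow> complex^'n) l. \<forall>i\<in>S. A *v e i = of_real (l i) *s e i \<and> (\<forall>j\<in>S. cip (e i) (e j) = (if i = j then 1 else 0))"
    if "finite S" for S :: "'n set"
    using that
  proof (induction S rule: finite_induct)
    case (insert k S)
    then obtain e l where e: "\<forall>i\<in>S. A *v e i = of_real (l i) *s e i"
      "\<forall>i\<in>S. \<forall>j\<in>S. cip (e i) (e j) = (if i = j then 1 else 0)" by blast
    have "S \<noteq> UNIV" using insert by auto
    from hermitian_ex_eigenvector_orthogonal[OF A this e(1)]
    obtain w \<mu> where w: "norm w = 1" "\<forall>i\<in>S. cip (e i) w = 0" "A *v w = of_real \<mu> *s w" by blast
    have w2: "cip w (e i) = 0" if "i \<in> S" for i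
      using w(2) that cnj_cip[of "e i" w] by simp
    show ?case
      by (rule exI[of _ "e(k := w)"], rule exI[of _ "l(k := \<mu>)"])
        (use insert.hyps w w2 e cip_self[of w] in auto)
  qed simp
  from this[of UNIV] show ?thesis by simp
qed

theorem hermitian_diagonalisation:
  fixes A :: "complex^'n^'n"
  assumes "hermitian A"
  obtains U :: "complex^'n^'n" and d where "adj U ** U = mat 1" "U ** adj U = mat 1" "A = U ** diag_mat d ** adj U"
proof -
  obtain e :: "'n \<Rightarrow> complex^'n" and l where e: "\<And>i. A *v e i = of_real (l i) *s e i"
    "\<And>i j. cip (e i) (e j) = (if i = j then 1 else 0)"
    using hermitian_orthonormal_eigenvectors[OF assms] by blast
  define U where "U = (\<chi> i j. e j $ i)"
  have 1: "adj U ** U = mat 1"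
    using e(2) by (simp add: vec_eq_iff matrix_mult_nth U_def mat_def cip_def)
  then have 2: "U ** adj U = mat 1" using matrix_left_right_inverse by blast
  have "A ** U = U ** diag_mat l"
  proof -
    have "(A ** U) $ i $ j = (U ** diag_mat l) $ i $ j" for i j
    proof -
      have "(A ** U) $ i $ j = (A *v e j) $ i"
        by (simp add: matrix_mult_nth matrix_vector_nth U_def)
      also have "\<dots> = of_real (l j) * e j $ i" by (simp add: e(1))
      also have "\<dots> = (U ** diag_mat l) $ i $ j"
        by (simp add: matrix_mult_nth U_def if_distrib sum.delta' cong: if_cong)
      finally show ?thesis .
    qed
    then show ?thesis by (simp add: vec_eq_iff)
  qed
  then have "A ** U ** adj U = U ** diag_mat l ** adj U" by simp
  then have "A = U ** diag_mat l ** adj U" using 2 by (simp add: matrix_mul_assoc[symmetric])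
  with 1 2 show thesis by (rule that)
qed

section \<open>Trace norm\<close>

lemma mtrace_add: "mtrace (A + B) = mtrace A + mtrace B"
  by (simp add: mtrace_def sum.distrib)

lemma mtrace_diff: "mtrace (A - B) = mtrace A - mtrace B"
  by (simp add: mtrace_def sum_subtractf)

lemma mtrace_cscale: "mtrace (cscale c A) = c * mtrace A"
  by (simp add: mtrace_def sum_distrib_left)

lemma mtrace_adj: "mtrace (adj A) = cnj (mtrace A)"
  by (simp add: mtrace_def)

lemma mtrace_mult_commute: "mtrace (A ** B) = mtrace (B ** A)"
  unfolding mtrace_def matrix_mult_nth by (subst sum.swap) (simp add: mult.commute)

lemma mtrace_diag_mat: "mtrace (diag_mat d) = of_real (\<Sum>i\<in>UNIV. d i)"
  by (simp add: mtrace_def)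

lemma diag_mat_mult: "diag_mat c ** diag_mat d = diag_mat (\<lambda>i. c i * d i)"
  by (simp add: vec_eq_iff matrix_mult_nth if_distrib[of "\<lambda>x. x * _"] cong: if_cong)

lemma qform_conj: "qform (U ** A ** adj U) v = qform A (adj U *v v)"
  by (simp add: qform_cip cip_adj[of _ U] flip: matrix_vector_mul_assoc)

lemma qform_diag_mat: "qform (diag_mat d) w = of_real (\<Sum>i\<in>UNIV. d i * (cmod (w$i))\<^sup>2)"
proof -
  have "(diag_mat d *v w) $ i = of_real (d i) * w $ i" for i
    by (simp add: matrix_vector_nth if_distrib[of "\<lambda>x. x * _"] cong: if_cong)
  then show ?thesis
    by (simp add: qform_cip cip_def complex_norm_square mult_ac del: of_real_power)
qed

lemma hermitian_diag_mat: "hermitian (diag_mat d)"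
  by (simp add: hermitian_def)

lemma hermitian_conj: "hermitian A \<Longrightarrow> hermitian (U ** A ** adj U)"
  by (simp add: hermitian_def adj_mult matrix_mul_assoc)

lemma hermitian_qform_psd:
  assumes "hermitian A" and "\<And>v. 0 \<le> Re (qform A v)"
  shows "psd A"
  using assms Im_qform_hermitian[of A] by (simp add: psd_def qform_cip)

lemma psd_conj: "psd A \<Longrightarrow> psd (U ** A ** adj U)"
  by (auto simp: psd_def hermitian_conj qform_conj)

lemma psd_diag_mat: "(\<And>i. 0 \<le> d i) \<Longrightarrow> psd (diag_mat d)"
  by (rule hermitian_qform_psd) (simp_all add: hermitian_diag_mat qform_diag_mat sum_nonneg)

lemma psd_adj_mult: "psd (adj A ** A)"
proof (rule hermitian_qform_psd)
  show "0 \<le> Re (qform (adj A ** A) v)" for v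
    by (simp add: qform_cip cip_adj[of _ "adj A"] cip_self flip: matrix_vector_mul_assoc del: of_real_power)
qed (simp add: hermitian_def adj_mult)

lemma norm_adj_unitary:
  fixes v :: "complex^'n" assumes "U ** adj U = mat 1" shows "norm (adj U *v v) = norm v"
proof -
  have "cip (adj U *v v) (adj U *v v) = cip v v"
    using assms by (simp add: cip_adj[of _ "adj U"] matrix_vector_mul_assoc)
  then show ?thesis by (simp add: cip_self del: of_real_power)
qed

lemma mtrace_unitary_conj:
  assumes "adj U ** U = mat 1" shows "mtrace (U ** A ** adj U) = mtrace A"
  using assms by (simp add: mtrace_mult_commute[of "U ** A"] matrix_mul_assoc)

lemma unitary_conj_mult:
  assumes "adj U ** U = mat 1"
  shows "(U ** A ** adj U) ** (U ** B ** adj U) = U ** (A ** B) ** adj U"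
proof -
  have "(U ** A ** adj U) ** (U ** B ** adj U) = U ** A ** (adj U ** U) ** B ** adj U"
    by (simp add: matrix_mul_assoc)
  then show ?thesis using assms by (simp add: matrix_mul_assoc)
qed

lemma unitary_conj_column:
  assumes "adj U ** U = mat 1" and "A = U ** diag_mat d ** adj U"
  shows "A *v column i U = of_real (d i) *s column i U"
proof -
  have AU: "A ** U = U ** diag_mat d"
    using assms by (simp flip: matrix_mul_assoc)
  have "(A *v column i U) $ k = (A ** U) $ k $ i" for k
    by (simp add: matrix_vector_nth column_def matrix_mult_nth)
  then show ?thesis
    by (simp add: vec_eq_iff AU matrix_mult_nth column_def if_distrib[of "\<lambda>x. _ * x"] mult.commute cong: if_cong)
qed

lemma unitary_column_norm:
  assumes "adj U ** U = mat 1"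
  shows "cip (column i U) (column i U) = 1"
proof -
  have "(adj U ** U) $ i $ i = 1" using assms by (simp add: mat_def)
  then show ?thesis by (simp add: matrix_mult_nth cip_def column_def)
qed

section \<open>Positive square roots and the matrix absolute value\<close>

lemma psd_diagonalisation:
  fixes A :: "complex^'n^'n"
  assumes "psd A"
  obtains U :: "complex^'n^'n" and d where "adj U ** U = mat 1" "U ** adj U = mat 1"
    "A = U ** diag_mat d ** adj U" "\<And>i. 0 \<le> d i"
proof -
  from assms have "hermitian A" by (simp add: psd_def)
  then obtain U :: "complex^'n^'n" and d where U: "adj U ** U = mat 1" "U ** adj U = mat 1" "A = U ** diag_mat d ** adj U"
    by (rule hermitian_diagonalisation)
  have "0 \<le> d i" for i
  proof -
    have "qform A (column i U) = of_real (d i)"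
      using unitary_conj_column[OF U(1,3), of i] unitary_column_norm[OF U(1), of i]
      by (simp add: qform_cip cip_smult_right)
    then show ?thesis using assms by (metis Re_complex_of_real psd_def)
  qed
  with U show thesis by (rule that)
qed

text \<open>Let \<open>u\<close> be a unit eigenvector of \<open>P - Q\<close> with eigenvalue
  \<open>m\<close>, and let \<open>p\<close>, \<open>q\<close> be the expectations of
  \<open>P\<close>, \<open>Q\<close> in \<open>u\<close>. Then \<open>m = p - q\<close>, while
  equality of the squares gives \<open>m * (p + q) = 0\<close>. As \<open>p\<close> and
  \<open>q\<close> are nonnegative, \<open>m\<close> is 0.\<close>

lemma psd_sqrt_unique:
  fixes P Q :: "complex^'n^'n"
  assumes P: "psd P" and Q: "psd Q" and eq: "P ** P = Q ** Q"
  shows "P = Q"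
proof -
  have herm: "hermitian (P - Q)" using P Q by (simp add: psd_def hermitian_def adj_diff)
  then obtain U :: "complex^'n^'n" and m where U: "adj U ** U = mat 1" "U ** adj U = mat 1" "P - Q = U ** diag_mat m ** adj U"
    by (rule hermitian_diagonalisation)
  have "m i = 0" for i
  proof -
    let ?u = "column i U"
    define p where "p = Re (qform P ?u)"
    define q where "q = Re (qform Q ?u)"
    have p: "cip ?u (P *v ?u) = of_real p" "p \<ge> 0"
      using P by (auto simp: p_def psd_def qform_cip complex_eq_iff)
    have q: "cip ?u (Q *v ?u) = of_real q" "q \<ge> 0"
      using Q by (auto simp: q_def psd_def qform_cip complex_eq_iff)
    have D: "(P - Q) *v ?u = of_real (m i) *s ?u" by (rule unitary_conj_column[OF U(1,3)])
    have "cip ?u ((P - Q) *v ?u) = of_real (m i)"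
      unfolding D using unitary_column_norm[OF U(1), of i] by (simp add: cip_smult_right)
    then have "complex_of_real (m i) = of_real (p - q)"
      using p q by (simp add: matrix_vector_mult_diff_rdistrib cip_diff_right)
    then have m: "m i = p - q" by (simp only: of_real_eq_iff)
    \<comment> \<open>The difference of squares without commutativity: P(P - Q) + (P - Q)Q = PP -
      QQ.\<close>
    have "P *v ((P - Q) *v ?u) + (P - Q) *v (Q *v ?u) = (P ** P) *v ?u - (Q ** Q) *v ?u"
      by (simp add: matrix_vector_mult_diff_rdistrib matrix_vector_mult_diff_distrib flip: matrix_vector_mul_assoc)
    also have "\<dots> = 0" by (simp add: eq)
    finally have "cip ?u (P *v ((P - Q) *v ?u)) + cip ?u ((P - Q) *v (Q *v ?u)) = 0"
      by (metis cip_add_right cip_zero(1))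
    moreover have "cip ?u ((P - Q) *v (Q *v ?u)) = of_real (m i * q)"
      unfolding cip_adj[of _ "P - Q"] using herm q by (simp add: D hermitian_def cip_smult_left)
    moreover have "cip ?u (P *v ((P - Q) *v ?u)) = of_real (m i * p)"
      unfolding D using p by (simp add: vector_scalar_commute cip_smult_right)
    ultimately have "complex_of_real (m i * (p + q)) = 0" by (simp add: algebra_simps)
    then have "m i * (p + q) = 0" by (simp only: of_real_eq_0_iff)
    then show ?thesis using m p(2) q(2) by auto
  qed
  then have "diag_mat m = 0" by (simp add: vec_eq_iff)
  then have "P - Q = 0" using U(3) by (simp add: vec_eq_iff matrix_mult_nth)
  then show ?thesis by simp
qed

text \<open>Uniqueness of the positive root turns the definite description in \<open>mat_abs\<close>
  into a criterion that can be checked on a candidate.\<close>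

lemma mat_abs_eq:
  assumes "psd Q" "Q ** Q = adj A ** A" shows "mat_abs A = Q"
  unfolding mat_abs_def
  using assms by (intro the_equality) (auto intro: psd_sqrt_unique)

lemma mat_abs_props:
  fixes A :: "complex^'n^'n"
  shows "psd (mat_abs A)" and "mat_abs A ** mat_abs A = adj A ** A"
proof -
  obtain U :: "complex^'n^'n" and d where U: "adj U ** U = mat 1" "U ** adj U = mat 1"
    "adj A ** A = U ** diag_mat d ** adj U" "\<And>i. 0 \<le> d i"
    using psd_diagonalisation[OF psd_adj_mult[of A]] by blast
  define Q where "Q = U ** diag_mat (\<lambda>i. sqrt (d i)) ** adj U"
  have Q: "psd Q" unfolding Q_def by (intro psd_conj psd_diag_mat) (simp add: U)
  have QQ: "Q ** Q = adj A ** A"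
    unfolding Q_def unitary_conj_mult[OF U(1)] diag_mat_mult using U(3,4) by simp
  from mat_abs_eq[OF Q QQ] Q QQ show "psd (mat_abs A)" "mat_abs A ** mat_abs A = adj A ** A" by simp_all
qed

lemma trace_norm_psd: "psd A \<Longrightarrow> trace_norm A = Re (mtrace A)"
  unfolding trace_norm_def by (subst mat_abs_eq[of A]) (auto simp: psd_def hermitian_def)

text \<open>The left side pairs \<open>A\<close> with the reflection 1 - 2|v><v|, whose operator
  norm is 1. In an eigenbasis of \<open>A\<close> the eigenvalues get weights in [-1, 1]. This is
  how a trace norm close to the trace limits the negativity of \<open>A\<close>.\<close>

lemma trace_norm_hermitian_ge:
  fixes A :: "complex^'n^'n"
  assumes "hermitian A" and v: "norm v = 1"
  shows "\<bar>Re (mtrace A) - 2 * Re (qform A v)\<bar> \<le> trace_norm A"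
proof -
  obtain U :: "complex^'n^'n" and d where U: "adj U ** U = mat 1" "U ** adj U = mat 1"
    "A = U ** diag_mat d ** adj U"
    using hermitian_diagonalisation[OF assms(1)] by blast
  define w where "w = adj U *v v"
  have nw: "norm w = 1" using norm_adj_unitary[OF U(2)] v by (simp add: w_def)
  have "mat_abs A = U ** diag_mat (\<lambda>i. \<bar>d i\<bar>) ** adj U"
    using assms(1)
    by (intro mat_abs_eq psd_conj psd_diag_mat)
       (simp_all add: hermitian_def, simp add: U(3) unitary_conj_mult[OF U(1)] diag_mat_mult)
  then have "trace_norm A = (\<Sum>i\<in>UNIV. \<bar>d i\<bar>)"
    by (simp add: trace_norm_def mtrace_unitary_conj[OF U(1)] mtrace_diag_mat)
  moreover have "Re (mtrace A) = (\<Sum>i\<in>UNIV. d i)"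
    by (simp add: U(3) mtrace_unitary_conj[OF U(1)] mtrace_diag_mat)
  moreover have "Re (qform A v) = (\<Sum>i\<in>UNIV. d i * (cmod (w$i))\<^sup>2)"
    by (simp add: U(3) qform_conj w_def[symmetric] qform_diag_mat)
  moreover have "\<bar>(\<Sum>i\<in>UNIV. d i) - 2 * (\<Sum>i\<in>UNIV. d i * (cmod (w$i))\<^sup>2)\<bar>
      \<le> (\<Sum>i\<in>UNIV. \<bar>d i\<bar>)"
  proof -
    have "(\<Sum>i\<in>UNIV. d i) - 2 * (\<Sum>i\<in>UNIV. d i * (cmod (w$i))\<^sup>2)
      = (\<Sum>i\<in>UNIV. d i * (1 - 2 * (cmod (w$i))\<^sup>2))"
      by (simp add: sum_distrib_left algebra_simps sum_subtractf)
    also have "\<bar>\<dots>\<bar> \<le> (\<Sum>i\<in>UNIV. \<bar>d i * (1 - 2 * (cmod (w$i))\<^sup>2)\<bar>)" by (rule sum_abs)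
    also have "\<dots> \<le> (\<Sum>i\<in>UNIV. \<bar>d i\<bar>)"
    proof (rule sum_mono)
      fix i
      have "(cmod (w$i))\<^sup>2 \<le> 1"
        using Finite_Cartesian_Product.norm_nth_le[of w i] nw by (simp add: power_le_one)
      then have "\<bar>1 - 2 * (cmod (w$i))\<^sup>2\<bar> \<le> 1" by (simp add: abs_le_iff)
      then show "\<bar>d i * (1 - 2 * (cmod (w$i))\<^sup>2)\<bar> \<le> \<bar>d i\<bar>"
        by (simp add: abs_mult mult_left_le)
    qed
    finally show ?thesis .
  qed
  ultimately show ?thesis by simp
qed

section \<open>Comparison of the trace norm with the Hilbert-Schmidt norm\<close>

lemma mtrace_adj_mult: "mtrace (adj A ** A) = of_real ((norm A)\<^sup>2)"
proof -
  have "mtrace (adj A ** A) = (\<Sum>i\<in>UNIV. \<Sum>k\<in>UNIV. of_real ((cmod (A$k$i))\<^sup>2))"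
    by (simp add: mtrace_def matrix_mult_nth complex_norm_square mult.commute del: of_real_power)
  also have "\<dots> = of_real ((norm A)\<^sup>2)"
    unfolding norm_mat_sq by (subst sum.swap) simp
  finally show ?thesis .
qed

lemma norm_mat_abs: "norm (mat_abs A) = norm A"
proof -
  have "mtrace (adj (mat_abs A) ** mat_abs A) = mtrace (adj A ** A)"
    using mat_abs_props[of A] by (simp add: psd_def hermitian_def)
  then have "(norm (mat_abs A))\<^sup>2 = (norm A)\<^sup>2"
    unfolding mtrace_adj_mult by (simp only: of_real_eq_iff)
  then show ?thesis by simp
qed

text \<open>On matrices, \<open>norm\<close> is the Hilbert-Schmidt norm, so this compares the
  2-norm and the 1-norm of the singular values. It also shows that a positive matrix of trace 0
  vanishes.\<close>

lemma norm_le_trace_norm: fixes A :: "complex^'n^'n" shows "norm A \<le> trace_norm A"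
proof -
  obtain U :: "complex^'n^'n" and d where U: "adj U ** U = mat 1" "U ** adj U = mat 1"
    "mat_abs A = U ** diag_mat d ** adj U" "\<And>i. 0 \<le> d i"
    using psd_diagonalisation[OF mat_abs_props(1)[of A]] by blast
  have "complex_of_real ((norm A)\<^sup>2) = mtrace (mat_abs A ** mat_abs A)"
    by (simp only: mat_abs_props(2) mtrace_adj_mult)
  also have "\<dots> = of_real (\<Sum>i\<in>UNIV. (d i)\<^sup>2)"
    unfolding U(3) unitary_conj_mult[OF U(1)] diag_mat_mult mtrace_unitary_conj[OF U(1)] mtrace_diag_mat
    by (simp add: power2_eq_square)
  finally have *: "(norm A)\<^sup>2 = (\<Sum>i\<in>UNIV. (d i)\<^sup>2)" by (simp only: of_real_eq_iff)
  have "norm A = L2_set d UNIV" by (simp add: L2_set_def flip: *)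
  also have "\<dots> \<le> (\<Sum>i\<in>UNIV. d i)" using L2_set_le_sum[of UNIV d] U(4) by simp
  also have "\<dots> = trace_norm A"
    by (simp add: trace_norm_def U(3) mtrace_unitary_conj[OF U(1)] mtrace_diag_mat)
  finally show ?thesis .
qed

lemma trace_norm_le_norm: fixes A :: "complex^'n^'n" shows "trace_norm A \<le> real CARD('n) * norm A"
proof -
  have "trace_norm A \<le> cmod (mtrace (mat_abs A))"
    by (simp add: trace_norm_def complex_Re_le_cmod)
  also have "\<dots> \<le> (\<Sum>i\<in>UNIV. cmod (mat_abs A $ i $ i))"
    unfolding mtrace_def by (rule norm_sum)
  also have "\<dots> \<le> (\<Sum>i\<in>(UNIV::'n set). norm A)"
    by (rule sum_mono) (metis Finite_Cartesian_Product.norm_nth_le norm_mat_abs order_trans)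
  finally show ?thesis by simp
qed

section \<open>Diamond norm and approximate positivity\<close>

definition outer :: "complex^'n \<Rightarrow> complex^'n^'n" where
  "outer v = (\<chi> i j. v$i * cnj (v$j))"

lemma sum_UNIV_prod: "(\<Sum>x\<in>UNIV. f (x :: 'a::finite \<times> 'b::finite)) = (\<Sum>i\<in>UNIV. \<Sum>j\<in>UNIV. f (i, j))"
  by (simp add: sum.cartesian_product)

lemma ketbra_nth [simp]: "ketbra i j $ a $ b = (if a = i \<and> b = j then 1 else 0)"
  by (simp add: ketbra_def)

lemma tensor_nth [simp]: "tensor A B $ x $ y = A $ fst x $ fst y * B $ snd x $ snd y"
  by (simp add: tensor_def)

lemma outer_nth [simp]: "outer v $ i $ j = v$i * cnj (v$j)"
  by (simp add: outer_def)

lemma scaleR_mat_nth: "(r *\<^sub>R A) $ i $ j = of_real r * (A :: complex^'n^'m) $ i $ j"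
  by (simp add: complex_eq_iff)

lemma scaleR_cscale: "r *\<^sub>R (A :: complex^'n^'m) = cscale (of_real r) A"
  by (simp add: vec_eq_iff scaleR_mat_nth del: vector_scaleR_component)

lemma mtrace_scaleR: "mtrace (r *\<^sub>R A) = of_real r * mtrace A"
  by (simp add: scaleR_cscale mtrace_cscale)

lemma mtrace_tensor: "mtrace (tensor A B) = mtrace A * mtrace B"
  by (simp add: mtrace_def sum_UNIV_prod sum_product)

lemma mtrace_outer: "mtrace (outer v) = of_real ((norm v)\<^sup>2)"
  by (simp add: mtrace_def norm_vec_sq complex_norm_square del: of_real_power)

lemma qform_add: "qform (A + B) v = qform A v + qform B v"
  by (simp add: qform_def sum.distrib algebra_simps)

lemma qform_cscale: "qform (cscale c A) v = c * qform A v"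
  by (simp add: qform_def sum_distrib_left algebra_simps)

lemma psd_scaleR:
  assumes "psd A" "r \<ge> 0" shows "psd (r *\<^sub>R A)"
proof (rule hermitian_qform_psd)
  have "adj (cscale (of_real r) A) = cscale (of_real r) (adj A)" by (simp add: vec_eq_iff)
  then show "hermitian (r *\<^sub>R A)" using assms by (simp add: psd_def hermitian_def scaleR_cscale)
  show "0 \<le> Re (qform (r *\<^sub>R A) v)" for v
    using assms by (simp add: psd_def scaleR_cscale qform_cscale)
qed

lemma qform_outer: "qform (outer u) v = of_real ((cmod (cip u v))\<^sup>2)"
proof -
  have "qform (outer u) v = cip v u * cip u v"
    by (simp add: qform_def cip_def sum_product algebra_simps)
  then show ?thesis by (simp add: complex_norm_square cnj_cip mult.commute del: of_real_power)
qed

lemma qform_tensor_ketbra: "qform (tensor A (ketbra k k)) w = qform A (\<chi> i. w $ (i, k))"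
proof -
  have "(tensor A (ketbra k k) *v w) $ (i, a) = (if a = k then (A *v (\<chi> i. w $ (i, k))) $ i else 0)" for i a
    by (simp add: matrix_vector_nth sum_UNIV_prod if_distrib[of "\<lambda>x. x * _"] if_distrib[of "\<lambda>x. _ * x"] cong: if_cong)
  then show ?thesis
    by (simp add: qform_cip cip_def sum_UNIV_prod if_distrib[of "\<lambda>x. _ * x"] cong: if_cong)
qed

text \<open>Contracting the first factor of \<open>w\<close> with \<open>v\<close> leaves the form
  of \<open>B\<close>, so positivity passes from \<open>B\<close> to the tensor product.\<close>

lemma qform_tensor_outer:
  "qform (tensor (outer v) B) w = qform B (\<chi> q. \<Sum>i\<in>UNIV. cnj (v$i) * w $ (i, q))" (is "?l = ?r")
proof -
  have "?l = (\<Sum>i\<in>UNIV. \<Sum>q\<in>UNIV. \<Sum>j\<in>UNIV. \<Sum>r\<in>UNIV.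
      cnj (w$(i,q)) * (v$i * cnj (v$j) * B$q$r) * w$(j,r))"
    by (simp add: qform_def sum_UNIV_prod)
  also have "\<dots> = (\<Sum>q\<in>UNIV. \<Sum>r\<in>UNIV. \<Sum>i\<in>UNIV. \<Sum>j\<in>UNIV.
      cnj (w$(i,q)) * (v$i * cnj (v$j) * B$q$r) * w$(j,r))"
  proof (subst sum.swap, rule sum.cong[OF refl])
    fix q
    show "(\<Sum>i\<in>UNIV. \<Sum>j\<in>UNIV. \<Sum>r\<in>UNIV. cnj (w$(i,q)) * (v$i * cnj (v$j) * B$q$r) * w$(j,r))
       = (\<Sum>r\<in>UNIV. \<Sum>i\<in>UNIV. \<Sum>j\<in>UNIV. cnj (w$(i,q)) * (v$i * cnj (v$j) * B$q$r) * w$(j,r))"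
      by (subst (2) sum.swap, rule sum.cong[OF refl], rule sum.swap)
  qed
  also have "\<dots> = ?r"
    by (simp add: qform_def sum_product sum_distrib_right sum_distrib_left algebra_simps)
  finally show ?thesis .
qed

lemma hermitian_tensor: "hermitian A \<Longrightarrow> hermitian B \<Longrightarrow> hermitian (tensor A B)"
  by (simp add: hermitian_def vec_eq_iff)

lemma hermitian_outer: "hermitian (outer v)"
  by (simp add: hermitian_def vec_eq_iff mult.commute)

lemma psd_tensor_ketbra: "psd A \<Longrightarrow> psd (tensor A (ketbra k k))"
  by (rule hermitian_qform_psd)
     (auto simp: psd_def qform_tensor_ketbra intro!: hermitian_tensor, simp add: hermitian_def vec_eq_iff)

lemma psd_tensor_outer: "psd B \<Longrightarrow> psd (tensor (outer v) B)"
  by (rule hermitian_qform_psd)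
     (auto simp: psd_def qform_tensor_outer intro!: hermitian_tensor hermitian_outer)

section \<open>Finiteness of the diamond norm and its bound on negativity\<close>

lemma hp_tp_linear_linear:
  assumes "hp_tp_linear P" shows "linear P"
  using assms by (intro linearI) (simp_all add: hp_tp_linear_def scaleR_cscale)

lemma linear_tensor_id:
  fixes P :: "complex^'a^'a \<Rightarrow> complex^'b^'b"
  assumes "linear P"
  shows "linear (tensor_id P :: complex^('a \<times> 'c::finite)^('a \<times> 'c) \<Rightarrow> complex^('b \<times> 'c)^('b \<times> 'c))"
proof (rule linearI)
  fix X Y :: "complex^('a \<times> 'c)^('a \<times> 'c)" and r :: real
  have *: "(\<chi> i j. (X + Y) $ (i, k) $ (j, l)) = (\<chi> i j. X $ (i, k) $ (j, l)) + (\<chi> i j. Y $ (i, k) $ (j, l))" for k l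
    by (simp add: vec_eq_iff)
  show "tensor_id P (X + Y) = tensor_id P X + tensor_id P Y"
    unfolding tensor_id_def * linear_add[OF assms] by (simp add: vec_eq_iff)
  have *: "(\<chi> i j. (r *\<^sub>R X) $ (i, k) $ (j, l)) = r *\<^sub>R (\<chi> i j. X $ (i, k) $ (j, l))" for k l
    by (simp add: vec_eq_iff)
  show "tensor_id P (r *\<^sub>R X) = r *\<^sub>R tensor_id P X"
    unfolding tensor_id_def * linear_scale[OF assms] by (simp add: vec_eq_iff)
qed

text \<open>A real \<open>SUP\<close> dominates its members only when the set is bounded. Linear
  maps in finite dimension are bounded, and the trace and Hilbert-Schmidt norms are
  equivalent.\<close>

lemma bdd_above_diamond:
  fixes P :: "complex^'a^'a \<Rightarrow> complex^'b^'b"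
  assumes "linear P"
  shows "bdd_above ((\<lambda>X. trace_norm (tensor_id P X)) ` {X :: complex^('a \<times> 'a)^('a \<times> 'a). trace_norm X \<le> 1})"
proof -
  let ?T = "tensor_id P :: complex^('a \<times> 'a)^('a \<times> 'a) \<Rightarrow> complex^('b \<times> 'a)^('b \<times> 'a)"
  obtain C where C: "C > 0" "\<And>X. norm (?T X) \<le> C * norm X"
    using linear_bounded_pos[OF linear_tensor_id[OF assms]] by blast
  show ?thesis
  proof (rule bdd_aboveI2)
    fix X :: "complex^('a \<times> 'a)^('a \<times> 'a)" assume "X \<in> {X. trace_norm X \<le> 1}"
    then have nX: "norm X \<le> 1" using norm_le_trace_norm[of X] by simp
    have "trace_norm (?T X) \<le> real CARD('b \<times> 'a) * norm (?T X)" by (rule trace_norm_le_norm)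
    also have "\<dots> \<le> real CARD('b \<times> 'a) * C"
      using C(2)[of X] C(1) nX by (intro mult_left_mono order_trans[OF C(2)]) (auto simp: mult_left_le)
    finally show "trace_norm (?T X) \<le> real CARD('b \<times> 'a) * C" .
  qed
qed

lemma tensor_id_tensor_ketbra:
  assumes "linear P" shows "tensor_id P (tensor Y (ketbra k k)) = tensor (P Y) (ketbra k k)"
proof -
  have "(\<chi> i j. tensor Y (ketbra k k) $ (i, a) $ (j, b)) = (if a = k \<and> b = k then Y else 0)" for a b
    by (simp add: vec_eq_iff)
  then show ?thesis
    using linear_0[OF assms] by (simp add: tensor_id_def vec_eq_iff)
qed

text \<open>A trace-preserving map of diamond norm close to 1 is almost positive.\<close>

lemma diamond_norm_qform_bound:
  fixes P :: "complex^'a^'a \<Rightarrow> complex^'b^'b"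
  assumes P: "hp_tp_linear P" and Y: "psd Y" and v: "norm v = 1"
  shows "\<bar>Re (mtrace Y) - 2 * Re (qform (P Y) v)\<bar> \<le> diamond_norm P * Re (mtrace Y)"
proof -
  note lin = hp_tp_linear_linear[OF P]
  have *: "\<bar>1 - 2 * Re (qform (P Z) v)\<bar> \<le> diamond_norm P" if Z: "psd Z" "Re (mtrace Z) = 1" for Z
  proof -
    \<comment> \<open>An arbitrary basis state \<open>k\<close> of the reference system makes
      \<open>Z\<close> an admissible input of the diamond norm; \<open>w\<close> is \<open>v\<close>
      tensored with that state.\<close>
    obtain k :: 'a where True by simp
    let ?X = "tensor Z (ketbra k k)"
    define w :: "complex^('b \<times> 'a)" where "w = (\<chi> x. if snd x = k then v $ fst x else 0)"
    have ket: "mtrace (ketbra k k) = 1" by (simp add: mtrace_def)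
    have tX: "trace_norm ?X \<le> 1"
      using Z by (simp add: trace_norm_psd psd_tensor_ketbra mtrace_tensor ket)
    have "(norm w)\<^sup>2 = (norm v)\<^sup>2"
      by (simp add: norm_vec_sq w_def sum_UNIV_prod if_distrib[of "\<lambda>x. (cmod x)\<^sup>2"] cong: if_cong)
    then have w: "norm w = 1" using v by (metis norm_ge_zero power2_eq_iff_nonneg)
    have "adj Z = Z" using Z by (simp add: psd_def hermitian_def)
    then have hP: "hermitian (P Z)" using P by (metis hermitian_def hp_tp_linear_def)
    have tP: "mtrace (P Z) = mtrace Z" using P by (simp add: hp_tp_linear_def)
    have h: "hermitian (tensor (P Z) (ketbra k k))"
      by (intro hermitian_tensor hP) (simp add: hermitian_def vec_eq_iff)
    have "\<bar>Re (mtrace (tensor (P Z) (ketbra k k))) - 2 * Re (qform (tensor (P Z) (ketbra k k)) w)\<bar>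
       \<le> trace_norm (tensor (P Z) (ketbra k k))"
      by (rule trace_norm_hermitian_ge[OF h w])
    moreover have "mtrace (tensor (P Z) (ketbra k k)) = mtrace Z"
      by (simp add: mtrace_tensor tP ket)
    moreover have "qform (tensor (P Z) (ketbra k k)) w = qform (P Z) v"
      by (simp add: qform_tensor_ketbra w_def)
    moreover have "trace_norm (tensor (P Z) (ketbra k k)) \<le> diamond_norm P"
      unfolding diamond_norm_def tensor_id_tensor_ketbra[OF lin, symmetric]
      by (rule cSUP_upper[OF _ bdd_above_diamond[OF lin]]) (simp add: tX)
    ultimately show ?thesis using Z(2) by simp
  qed
  \<comment> \<open>Both sides are homogeneous in \<open>Y\<close>, so trace one suffices, except
    for trace 0, where \<open>Y\<close> itself is 0.\<close>
  define t where "t = Re (mtrace Y)"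
  have t: "t = trace_norm Y" using Y by (simp add: t_def trace_norm_psd)
  show ?thesis
  proof (cases "t = 0")
    case True
    then have "norm Y \<le> 0" using norm_le_trace_norm[of Y] t by simp
    then have "Y = 0" by simp
    then show ?thesis using linear_0[OF lin] by (simp add: mtrace_def qform_def)
  next
    case False
    then have tp: "t > 0" using norm_le_trace_norm[of Y] t by (smt (verit) norm_ge_zero)
    define Z where "Z = (1 / t) *\<^sub>R Y"
    have "psd Z" unfolding Z_def using Y tp by (intro psd_scaleR) auto
    moreover have "Re (mtrace Z) = 1" using tp by (simp add: Z_def mtrace_scaleR t_def[symmetric])
    ultimately have "\<bar>1 - 2 * Re (qform (P Z) v)\<bar> \<le> diamond_norm P" by (rule *)
    moreover have "Re (qform (P Z) v) = Re (qform (P Y) v) / t"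
      unfolding Z_def linear_scale[OF lin] by (simp add: scaleR_cscale qform_cscale)
    ultimately have "\<bar>1 - 2 * (Re (qform (P Y) v) / t)\<bar> * t \<le> diamond_norm P * t"
      using tp by (simp add: mult_right_mono)
    moreover have "\<bar>1 - 2 * (Re (qform (P Y) v) / t)\<bar> * t = \<bar>(1 - 2 * (Re (qform (P Y) v) / t)) * t\<bar>"
      using tp by (simp add: abs_mult)
    moreover have "(1 - 2 * (Re (qform (P Y) v) / t)) * t = t - 2 * Re (qform (P Y) v)"
      using tp by (simp add: field_simps)
    ultimately show ?thesis by (simp add: t_def)
  qed
qed

section \<open>Blocks relative to a pure state and the diamond norm gap\<close>

lemma matrix_mult_scaleR_left: "(r *\<^sub>R A) ** B = r *\<^sub>R (A ** (B :: complex^'n^'m))"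
  by (simp add: vec_eq_iff matrix_mult_nth scaleR_right.sum)

lemma matrix_mult_scaleR_right: "A ** (r *\<^sub>R B) = r *\<^sub>R (A ** (B :: complex^'n^'m))"
  by (simp add: vec_eq_iff matrix_mult_nth scaleR_right.sum)

lemma matrix_mult_diff_left: "(A - B) ** C = A ** C - B ** (C :: complex^'n^'m)"
  by (simp add: vec_eq_iff matrix_mult_nth left_diff_distrib sum_subtractf)

lemma matrix_mult_diff_right: "C ** (A - B) = C ** A - C ** (B :: complex^'n^'m)"
  by (simp add: vec_eq_iff matrix_mult_nth right_diff_distrib sum_subtractf)

lemma matrix_mult_add_left: "(A + B) ** C = A ** C + B ** (C :: complex^'n^'m)"
  by (simp add: vec_eq_iff matrix_mult_nth distrib_right sum.distrib)

lemma outer_mult_outer: "outer u ** A ** outer u = cscale (qform A u) (outer u)"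
  by (simp add: vec_eq_iff matrix_mult_nth qform_def sum_distrib_left sum_distrib_right, subst sum.swap)
     (simp add: algebra_simps)

lemma mtrace_mult_outer: "mtrace (A ** outer u) = qform A u"
  by (simp add: mtrace_def matrix_mult_nth qform_def algebra_simps)

text \<open>\<open>W\<close> weights the two blocks by \<open>h\<close> and \<open>- 1 / h\<close>,
  so the off-diagonal blocks of \<open>W ** \<rho> ** W\<close> carry the coefficient -1 and cancel
  those of \<rho>.\<close>

lemma pinching_identity:
  fixes \<rho> \<Phi> :: "complex^'n^'n"
  assumes "h \<noteq> 0"
  defines "W \<equiv> h *\<^sub>R (mat 1 - \<Phi>) - (1 / h) *\<^sub>R \<Phi>"
  shows "\<rho> + W ** \<rho> ** W = (1 + h\<^sup>2) *\<^sub>R ((mat 1 - \<Phi>) ** \<rho> ** (mat 1 - \<Phi>)) + (1 + 1 / h\<^sup>2) *\<^sub>R (\<Phi> ** \<rho> ** \<Phi>)"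
proof -
  define Q where "Q = mat 1 - \<Phi>"
  have "\<rho> = (Q + \<Phi>) ** \<rho> ** (Q + \<Phi>)" by (simp add: Q_def)
  also have "\<dots> = Q ** \<rho> ** Q + Q ** \<rho> ** \<Phi> + \<Phi> ** \<rho> ** Q + \<Phi> ** \<rho> ** \<Phi>"
    by (simp add: matrix_add_ldistrib matrix_mult_add_left)
  finally have 1: "\<rho> = Q ** \<rho> ** Q + Q ** \<rho> ** \<Phi> + \<Phi> ** \<rho> ** Q + \<Phi> ** \<rho> ** \<Phi>" .
  have 2: "W ** \<rho> ** W = h\<^sup>2 *\<^sub>R (Q ** \<rho> ** Q) - Q ** \<rho> ** \<Phi> - \<Phi> ** \<rho> ** Q + (1 / h\<^sup>2) *\<^sub>R (\<Phi> ** \<rho> ** \<Phi>)"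
    using assms(1) unfolding W_def Q_def[symmetric]
    by (simp add: matrix_mult_diff_left matrix_mult_diff_right matrix_mult_scaleR_left matrix_mult_scaleR_right
        power2_eq_square scaleR_right_diff_distrib)
  have "r = a + b + c + e \<Longrightarrow> w = x - b - c + y \<Longrightarrow> r + w = (a + x) + (e + y)"
    for r a b c e w x y :: "complex^'n^'n" by simp
  from this[OF 1 2] show ?thesis unfolding Q_def[symmetric] by (simp only: scaleR_add_left scaleR_one)
qed

text \<open>The off-diagonal blocks of \<open>\<rho>\<close> relative to \<open>\<phi>\<close> are absorbed into the diagonal ones
  by \<open>pinching_identity\<close>, at the price of \<open>\<eta>\<close>.\<close>

lemma approx_effect_bound:
  fixes P :: "complex^('n::finite \<times> 'p::finite)^('n \<times> 'p) \<Rightarrow> complex^'n^'n"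
  assumes P: "hp_tp_linear P" and D: "diamond_norm P \<le> 1 + \<epsilon>"
    and v: "norm v = 1" and \<phi>: "norm \<phi> = 1"
    and fixed: "P (tensor (outer v) (outer \<phi>)) = outer v"
    and \<rho>: "psd \<rho>" "mtrace \<rho> = 1" and s: "qform \<rho> \<phi> = of_real s" and \<eta>: "\<eta> > 0"
  shows "1 - Re (qform (P (tensor (outer v) \<rho>)) v)
    \<le> (1 + \<eta>) * (1 + \<epsilon> / 2) * (1 - s) + \<epsilon> / 2 * ((1 + \<eta>) * (1 - s) + (1 + 1 / \<eta>) * s - 1)"
proof -
  note lin = hp_tp_linear_linear[OF P]
  \<comment> \<open>As \<open>P\<close> preserves the trace and \<open>v\<close> is a unit vector,
    this is the real part of tr((1 - |v><v|) P(|v><v| \<otimes> Y)): the weight of the output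
    outside \<open>v\<close>.\<close>
  define g where "g Y = Re (mtrace Y) - Re (qform (P (tensor (outer v) Y)) v)" for Y
  have t_add: "tensor (outer v) (X + Y) = tensor (outer v) X + tensor (outer v) Y" for X Y :: "complex^'p^'p"
    by (simp add: vec_eq_iff algebra_simps)
  have t_sc: "tensor (outer v) (r *\<^sub>R X) = r *\<^sub>R tensor (outer v) X" for r and X :: "complex^'p^'p"
    by (simp add: vec_eq_iff algebra_simps)
  have g_add: "g (X + Y) = g X + g Y" for X Y
    by (simp add: g_def t_add linear_add[OF lin] qform_add mtrace_add)
  have g_sc: "g (r *\<^sub>R X) = r * g X" for r X
    unfolding g_def t_sc linear_scale[OF lin] by (simp add: scaleR_cscale qform_cscale mtrace_cscale right_diff_distrib)
  have mv: "mtrace (outer v) = 1" using v by (simp add: mtrace_outer)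
  \<comment> \<open>Approximate positivity makes \<open>g\<close> an approximate effect: on positive
    matrices of trace t its values lie between -\<epsilon>t/2 and (1 + \<epsilon>/2)t.\<close>
  have g_bounds: "- (\<epsilon> / 2) * Re (mtrace Y) \<le> g Y \<and> g Y \<le> (1 + \<epsilon> / 2) * Re (mtrace Y)" if Y: "psd Y" for Y
  proof -
    let ?q = "Re (qform (P (tensor (outer v) Y)) v)" and ?t = "Re (mtrace Y)"
    have t0: "0 \<le> ?t" using trace_norm_psd[OF Y] norm_le_trace_norm[of Y] by (metis norm_ge_zero order_trans)
    have "\<bar>?t - 2 * ?q\<bar> \<le> diamond_norm P * ?t"
      using diamond_norm_qform_bound[OF P psd_tensor_outer[OF Y] v, of v] by (simp add: mtrace_tensor mv)
    also have "\<dots> \<le> (1 + \<epsilon>) * ?t" using D t0 by (rule mult_right_mono)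
    finally show ?thesis unfolding g_def abs_le_iff by (simp add: field_simps)
  qed
  define \<Phi> where "\<Phi> = outer \<phi>"
  define Q where "Q = mat 1 - \<Phi>"
  define h where "h = sqrt \<eta>"
  define W where "W = h *\<^sub>R Q - (1 / h) *\<^sub>R \<Phi>"
  have h: "h \<noteq> 0" "h\<^sup>2 = \<eta>" using \<eta> by (auto simp: h_def)
  have id: "\<rho> + W ** \<rho> ** W = (1 + \<eta>) *\<^sub>R (Q ** \<rho> ** Q) + (1 + 1 / \<eta>) *\<^sub>R (\<Phi> ** \<rho> ** \<Phi>)"
    using pinching_identity[OF h(1), of \<rho> \<Phi>] by (simp add: W_def Q_def h(2))
  have adjP: "adj \<Phi> = \<Phi>" using hermitian_outer[of \<phi>] by (simp add: \<Phi>_def hermitian_def)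
  have adjQ: "adj Q = Q" by (simp add: Q_def adj_diff adjP) (simp add: vec_eq_iff mat_def)
  have adjW: "adj W = W"
  proof -
    have "adj (r *\<^sub>R A) = r *\<^sub>R adj A" for r and A :: "complex^'p^'p"
      by (simp add: vec_eq_iff complex_eq_iff)
    then show ?thesis by (simp only: W_def adj_diff adjP adjQ)
  qed
  have PP: "\<Phi> ** \<Phi> = \<Phi>"
    using outer_mult_outer[of \<phi> "mat 1"] \<phi> 
    by (simp add: \<Phi>_def qform_cip cip_self) (simp add: vec_eq_iff)
  have QQ: "Q ** Q = Q" by (simp add: Q_def matrix_mult_diff_left matrix_mult_diff_right PP)
  have PrP: "\<Phi> ** \<rho> ** \<Phi> = s *\<^sub>R \<Phi>"
    by (simp add: \<Phi>_def outer_mult_outer s scaleR_cscale)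
  have psdQ: "psd (Q ** \<rho> ** Q)" using psd_conj[OF \<rho>(1), of Q] by (simp add: adjQ)
  have psdW: "psd (W ** \<rho> ** W)" using psd_conj[OF \<rho>(1), of W] by (simp add: adjW)
  have "mtrace (Q ** \<rho> ** Q) = mtrace (\<rho> ** Q)"
    by (subst mtrace_mult_commute) (simp add: matrix_mul_assoc QQ, subst mtrace_mult_commute, simp)
  also have "\<dots> = 1 - of_real s"
    by (simp add: Q_def matrix_mult_diff_right mtrace_diff \<rho> \<Phi>_def mtrace_mult_outer s)
  finally have trQ: "mtrace (Q ** \<rho> ** Q) = of_real (1 - s)" by simp
  have trP: "mtrace \<Phi> = 1" using \<phi> by (simp add: \<Phi>_def mtrace_outer)
  have "mtrace (\<rho> + W ** \<rho> ** W) = of_real ((1 + \<eta>) * (1 - s) + (1 + 1 / \<eta>) * s)"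
    unfolding id by (simp add: mtrace_add mtrace_scaleR trQ trP PrP)
  then have "Re (mtrace (\<rho> + W ** \<rho> ** W)) = (1 + \<eta>) * (1 - s) + (1 + 1 / \<eta>) * s"
    by (simp only: Re_complex_of_real)
  then have trW: "Re (mtrace (W ** \<rho> ** W)) = (1 + \<eta>) * (1 - s) + (1 + 1 / \<eta>) * s - 1"
    by (simp add: mtrace_add \<rho>)
  have gP: "g \<Phi> = 0"
    using v by (simp add: g_def trP \<Phi>_def[symmetric] fixed[folded \<Phi>_def] qform_outer cip_self)
  \<comment> \<open>Applying \<open>g\<close> to the pinching identity, the \<Phi> block drops out
    because \<open>P\<close> returns \<open>v\<close> exactly there. The auxiliary positive matrix
    \<open>W ** \<rho> ** W\<close> costs at most \<epsilon>/2 times its trace.\<close>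
  have "g \<rho> + g (W ** \<rho> ** W) = (1 + \<eta>) * g (Q ** \<rho> ** Q)"
    unfolding g_add[symmetric] id by (simp add: g_add g_sc PrP gP)
  also have "\<dots> \<le> (1 + \<eta>) * ((1 + \<epsilon> / 2) * (1 - s))"
    using g_bounds[OF psdQ] \<eta> by (intro mult_left_mono) (auto simp: trQ)
  finally have "g \<rho> \<le> (1 + \<eta>) * (1 + \<epsilon> / 2) * (1 - s) - g (W ** \<rho> ** W)" by simp
  moreover have "- (\<epsilon> / 2) * ((1 + \<eta>) * (1 - s) + (1 + 1 / \<eta>) * s - 1) \<le> g (W ** \<rho> ** W)"
    using g_bounds[OF psdW] unfolding trW by blast
  ultimately have "g \<rho> \<le> (1 + \<eta>) * (1 + \<epsilon> / 2) * (1 - s) + \<epsilon> / 2 * ((1 + \<eta>) * (1 - s) + (1 + 1 / \<eta>) * s - 1)"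
    by linarith
  then show ?thesis by (simp add: g_def \<rho>)
qed

text \<open>With both errors at 0 the bound of \<open>approx_effect_bound\<close> would read 1 - lam
  \<le> 1 - s, contrary to \<open>lam < s\<close>. The gap \<epsilon> is built from \<open>s\<close>
  and \<open>lam\<close> alone; this uniformity in \<open>P\<close> is what an infimum over all
  \<open>P\<close> requires.\<close>

lemma diamond_norm_gap:
  fixes v :: "complex^'n" and \<phi> :: "complex^'p"
  assumes v: "norm v = 1" and \<phi>: "norm \<phi> = 1" and \<rho>: "psd \<rho>" "mtrace \<rho> = 1"
    and s: "qform \<rho> \<phi> = of_real s" and lam: "lam < s"
  obtains \<epsilon> where "\<epsilon> > 0"
    "\<And>P :: complex^('n \<times> 'p)^('n \<times> 'p) \<Rightarrow> complex^'n^'n. hp_tp_linear P \<Longrightarrow>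
      P (tensor (outer v) (outer \<phi>)) = outer v \<Longrightarrow>
      Re (qform (P (tensor (outer v) \<rho>)) v) = lam \<Longrightarrow> 1 + \<epsilon> < diamond_norm P"
proof -
  define u where "u = s - lam"
  have u: "u > 0" using lam by (simp add: u_def)
  have s0: "0 \<le> s" using \<rho>(1) s by (metis Re_complex_of_real psd_def)
  define \<eta> where "\<eta> = u / 2"
  have \<eta>: "\<eta> > 0" using u by (simp add: \<eta>_def)
  \<comment> \<open>\<open>C\<close> is the coefficient of \<epsilon> in the bound. The choices make
    the error from \<eta> at most u/2 and the one from \<epsilon> at most u/4, together less than
    u.\<close>
  define C where "C = ((1 + \<eta>) * (1 - s) + ((1 + \<eta>) * (1 - s) + (1 + 1 / \<eta>) * s - 1)) / 2"
  define \<epsilon> where "\<epsilon> = u / (4 * (\<bar>C\<bar> + 1))"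
  have e: "\<epsilon> > 0" using u by (simp add: \<epsilon>_def)
  have "\<epsilon> * C \<le> \<epsilon> * (\<bar>C\<bar> + 1)" using e by (intro mult_left_mono) auto
  also have "\<dots> = u / 4"
  proof -
    have "c \<noteq> 0 \<Longrightarrow> u / (4 * c) * c = u / 4" for c by simp
    moreover have "\<bar>C\<bar> + 1 \<noteq> 0" by linarith
    ultimately show ?thesis by (simp only: \<epsilon>_def)
  qed
  finally have eC: "\<epsilon> * C \<le> u / 4" .
  show thesis
  proof (rule that[OF e], rule ccontr)
    fix P :: "complex^('n \<times> 'p)^('n \<times> 'p) \<Rightarrow> complex^'n^'n"
    assume P: "hp_tp_linear P" "P (tensor (outer v) (outer \<phi>)) = outer v"
      "Re (qform (P (tensor (outer v) \<rho>)) v) = lam" and "\<not> 1 + \<epsilon> < diamond_norm P"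
    then have D: "diamond_norm P \<le> 1 + \<epsilon>" by simp
    have "1 - lam \<le> (1 + \<eta>) * (1 + \<epsilon> / 2) * (1 - s) + \<epsilon> / 2 * ((1 + \<eta>) * (1 - s) + (1 + 1 / \<eta>) * s - 1)"
      using approx_effect_bound[OF P(1) D v \<phi> P(2) \<rho> s \<eta>] P(3) by simp
    also have "\<dots> = (1 + \<eta>) * (1 - s) + \<epsilon> * C"
      by (simp add: C_def algebra_simps add_divide_distrib diff_divide_distrib)
    also have "\<dots> \<le> 1 - s + \<eta> + u / 4"
    proof -
      have "0 \<le> \<eta> * s" using \<eta> s0 by simp
      then show ?thesis using eC by (simp add: algebra_simps)
    qed
    finally show False using u \<eta>_def u_def by linarith
  qed
qed

section \<open>The kernel of a Lindbladian\<close>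

definition dissipator :: "complex^'n^'n \<Rightarrow> complex^'n^'n \<Rightarrow> complex^'n^'n" where
  "dissipator K \<rho> = K ** \<rho> ** adj K - cscale (1/2) (adj K ** K ** \<rho> + \<rho> ** (adj K ** K))"

lemma gksl_dissipator:
  "gksl H Ls \<rho> = cscale (-\<i>) (H ** \<rho> - \<rho> ** H) + sum_list (map (\<lambda>K. dissipator K \<rho>) Ls)"
  by (simp add: gksl_def dissipator_def)

lemma cscale_add: "cscale c (A + B) = cscale c A + cscale c B"
  by (simp add: vec_eq_iff algebra_simps)

lemma cscale_diff: "cscale c (A - B) = cscale c A - cscale c B"
  by (simp add: vec_eq_iff algebra_simps)

lemma cscale_cscale: "cscale a (cscale b A) = cscale (a * b) A"
  by (simp add: vec_eq_iff)

lemma cscale_one [simp]: "cscale 1 A = A"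
  by (simp add: vec_eq_iff)

lemma cscale_zero [simp]: "cscale c 0 = 0" "cscale 0 A = 0"
  by (simp_all add: vec_eq_iff)

lemma adj_cscale: "adj (cscale c A) = cscale (cnj c) (adj A)"
  by (simp add: vec_eq_iff)

lemma matrix_mult_cscale_left: "cscale c A ** B = cscale c (A ** B)"
  by (simp add: vec_eq_iff matrix_mult_nth sum_distrib_left algebra_simps)

lemma matrix_mult_cscale_right: "A ** cscale c B = cscale c (A ** B)"
  by (simp add: vec_eq_iff matrix_mult_nth sum_distrib_left algebra_simps)

lemma dissipator_add: "dissipator K (X + Y) = dissipator K X + dissipator K Y"
  by (simp add: dissipator_def matrix_add_ldistrib matrix_mult_add_left cscale_add)

lemma dissipator_cscale: "dissipator K (cscale c X) = cscale c (dissipator K X)"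
  by (simp add: dissipator_def matrix_mult_cscale_left matrix_mult_cscale_right cscale_diff cscale_add
      cscale_cscale mult.commute)

lemma dissipator_adj: "dissipator K (adj X) = adj (dissipator K X)"
  by (simp add: dissipator_def adj_diff adj_add adj_cscale adj_mult matrix_mul_assoc add.commute)

lemma mtrace_dissipator: "mtrace (dissipator K X) = 0"
proof -
  have "mtrace (K ** X ** adj K) = mtrace (adj K ** K ** X)"
    by (subst mtrace_mult_commute) (simp add: matrix_mul_assoc)
  moreover have "mtrace (X ** (adj K ** K)) = mtrace (adj K ** K ** X)"
    by (rule mtrace_mult_commute)
  ultimately show ?thesis by (simp add: dissipator_def mtrace_diff mtrace_add mtrace_cscale)
qed

section \<open>Linearity, symmetries and trace of the GKSL generator\<close>

lemma gksl_add: "gksl H Ls (X + Y) = gksl H Ls X + gksl H Ls Y"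
proof -
  have "sum_list (map (\<lambda>K. dissipator K (X + Y)) Ls)
    = sum_list (map (\<lambda>K. dissipator K X) Ls) + sum_list (map (\<lambda>K. dissipator K Y) Ls)"
    by (simp add: dissipator_add sum_list_addf)
  moreover have "cscale (-\<i>) (H ** (X + Y) - (X + Y) ** H)
    = cscale (-\<i>) (H ** X - X ** H) + cscale (-\<i>) (H ** Y - Y ** H)"
    by (simp add: matrix_add_ldistrib matrix_mult_add_left flip: cscale_add) (simp add: algebra_simps)
  ultimately show ?thesis by (simp add: gksl_dissipator)
qed

lemma gksl_cscale: "gksl H Ls (cscale c X) = cscale c (gksl H Ls X)"
proof -
  have "sum_list (map (\<lambda>K. dissipator K (cscale c X)) Ls) = cscale c (sum_list (map (\<lambda>K. dissipator K X) Ls))"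
    by (induction Ls) (simp_all add: dissipator_cscale cscale_add)
  then show ?thesis
    by (simp add: gksl_dissipator matrix_mult_cscale_left matrix_mult_cscale_right cscale_add cscale_diff
        cscale_cscale mult.commute)
qed

lemma gksl_adj:
  assumes "hermitian H" shows "gksl H Ls (adj X) = adj (gksl H Ls X)"
proof -
  have "sum_list (map (\<lambda>K. dissipator K (adj X)) Ls) = adj (sum_list (map (\<lambda>K. dissipator K X) Ls))"
    by (induction Ls) (simp_all add: dissipator_adj adj_add, simp add: vec_eq_iff)
  moreover have "cscale (-\<i>) (H ** adj X - adj X ** H) = adj (cscale (-\<i>) (H ** X - X ** H))"
    using assms by (simp add: hermitian_def adj_cscale adj_diff adj_mult) (simp add: vec_eq_iff algebra_simps)
  ultimately show ?thesis by (simp add: gksl_dissipator adj_add)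
qed

lemma mtrace_gksl: "mtrace (gksl H Ls X) = 0"
proof -
  have "mtrace (sum_list (map (\<lambda>K. dissipator K X) Ls)) = 0"
    by (induction Ls) (simp_all add: mtrace_dissipator mtrace_add, simp add: mtrace_def)
  then show ?thesis
    by (simp add: gksl_dissipator mtrace_add mtrace_cscale mtrace_diff mtrace_mult_commute[of H])
qed

text \<open>GKSL form survives a change of orthonormal basis, so a Hermitian kernel element may be
  taken diagonal.\<close>

lemma gksl_unitary_conj:
  assumes U: "adj U ** U = mat 1" "U ** adj U = mat 1"
  shows "gksl H Ls (U ** X ** adj U) = U ** gksl (adj U ** H ** U) (map (\<lambda>K. adj U ** K ** U) Ls) X ** adj U"
proof -
  define c where "c A = U ** A ** adj U" for A
  have c_mult: "c A ** c B = c (A ** B)" for A B unfolding c_def by (rule unitary_conj_mult[OF U(1)])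
  have c_adj: "adj (c A) = c (adj A)" for A by (simp add: c_def adj_mult matrix_mul_assoc)
  have c_add: "c (A + B) = c A + c B" for A B by (simp add: c_def matrix_add_ldistrib matrix_mult_add_left)
  have c_diff: "c (A - B) = c A - c B" for A B by (simp add: c_def matrix_mult_diff_right matrix_mult_diff_left)
  have c_sc: "c (cscale z A) = cscale z (c A)" for z A by (simp add: c_def matrix_mult_cscale_left matrix_mult_cscale_right)
  have c_inv: "c (adj U ** A ** U) = A" for A
  proof -
    have "c (adj U ** A ** U) = (U ** adj U) ** A ** (U ** adj U)" by (simp add: c_def matrix_mul_assoc)
    then show ?thesis by (simp add: U)
  qed
  have d: "dissipator K (c X) = c (dissipator (adj U ** K ** U) X)" for K
  proof -
    have "dissipator (c K') (c X) = c (dissipator K' X)" for K'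
      by (simp only: dissipator_def c_mult c_adj c_add c_diff c_sc)
    from this[of "adj U ** K ** U"] show ?thesis by (simp only: c_inv)
  qed
  have "sum_list (map (\<lambda>K. dissipator K (c X)) Ls)
    = c (sum_list (map (\<lambda>K. dissipator K X) (map (\<lambda>K. adj U ** K ** U) Ls)))"
  proof (induction Ls)
    case Nil
    show ?case by (simp add: c_def vec_eq_iff matrix_mult_nth)
  qed (simp add: c_add d)
  moreover have "cscale (-\<i>) (H ** c X - c X ** H) =
    c (cscale (-\<i>) ((adj U ** H ** U) ** X - X ** (adj U ** H ** U)))"
    unfolding c_sc c_diff c_mult[symmetric] c_inv ..
  ultimately show ?thesis unfolding c_def[symmetric] gksl_dissipator c_add by simp
qed

text \<open>Here \<open>w j i\<close> is the jump rate from \<open>i\<close> to \<open>j\<close>. For a diagonal \<open>X\<close>, the diagonal of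
  \<open>L X = 0\<close> is the stationarity equation of a classical Markov chain.\<close>

lemma stationary_support_closed:
  fixes w :: "'n::finite \<Rightarrow> 'n \<Rightarrow> real" and x :: "'n \<Rightarrow> real"
  assumes w: "\<And>i j. 0 \<le> w i j"
    and st: "\<And>i. (\<Sum>l\<in>UNIV. w i l * x l) = (\<Sum>m\<in>UNIV. w m i) * x i"
    and ij: "x i > 0" "\<not> x j > 0"
  shows "w j i = 0"
proof -
  define S where "S = {i. x i > 0}"
  have split: "(\<Sum>l\<in>UNIV. f l) = (\<Sum>l\<in>S. f l) + (\<Sum>l\<in>-S. f l)" for f :: "'n \<Rightarrow> real"
    by (subst sum.union_disjoint[symmetric]) (auto simp: Compl_partition)
  \<comment> \<open>Summed over \<open>S\<close>, the flows inside \<open>S\<close> cancel. The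
    inflow from outside is at most 0, since \<open>x\<close> is not positive there, and it equals
    the outflow, a sum of nonnegative terms. Hence each outflow term is 0.\<close>
  have "(\<Sum>i\<in>S. \<Sum>l\<in>UNIV. w i l * x l) = (\<Sum>i\<in>S. \<Sum>m\<in>UNIV. w m i * x i)"
    by (simp add: st sum_distrib_right)
  then have "(\<Sum>i\<in>S. \<Sum>l\<in>S. w i l * x l) + (\<Sum>i\<in>S. \<Sum>l\<in>-S. w i l * x l)
    = (\<Sum>i\<in>S. \<Sum>m\<in>S. w m i * x i) + (\<Sum>i\<in>S. \<Sum>m\<in>-S. w m i * x i)"
    by (simp add: split sum.distrib)
  moreover have "(\<Sum>i\<in>S. \<Sum>l\<in>S. w i l * x l) = (\<Sum>i\<in>S. \<Sum>m\<in>S. w m i * x i)"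
    by (rule sum.swap)
  ultimately have eq: "(\<Sum>i\<in>S. \<Sum>l\<in>-S. w i l * x l) = (\<Sum>i\<in>S. \<Sum>m\<in>-S. w m i * x i)" by simp
  have "(\<Sum>i\<in>S. \<Sum>l\<in>-S. w i l * x l) \<le> 0"
    using w by (intro sum_nonpos) (auto simp: S_def mult_nonneg_nonpos)
  then have le: "(\<Sum>i\<in>S. \<Sum>m\<in>-S. w m i * x i) \<le> 0" using eq by simp
  have nn: "0 \<le> w m i * x i" if "i \<in> S" for m i using w that by (simp add: S_def)
  have "(\<Sum>i\<in>S. \<Sum>m\<in>-S. w m i * x i) = 0"
    using le nn by (intro antisym sum_nonneg) auto
  then have "(\<Sum>m\<in>-S. w m i * x i) = 0"
    using nn ij by (subst (asm) sum_nonneg_eq_0_iff) (auto simp: S_def intro!: sum_nonneg)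
  then have "w j i * x i = 0"
    using nn ij by (subst (asm) sum_nonneg_eq_0_iff) (auto simp: S_def)
  then show ?thesis using ij by simp
qed

lemma sum_list_mat_nth: "sum_list Ms $ i $ j = sum_list (map (\<lambda>M. M $ i $ j) Ms)"
  by (induction Ms) simp_all

text \<open>The three lines stem from the Hamiltonian, the jumps and the anticommutator; the support
  argument for \<open>gksl_diag_pos_part\<close> treats them separately.\<close>

lemma gksl_diag_nth:
  "gksl H Ls (diag_mat x) $ i $ j =
     - \<i> * H $ i $ j * of_real (x j - x i)
     + (\<Sum>k<length Ls. \<Sum>l\<in>UNIV. (Ls ! k) $ i $ l * of_real (x l) * cnj ((Ls ! k) $ j $ l))
     - (\<Sum>k<length Ls. \<Sum>m\<in>UNIV. cnj ((Ls ! k) $ m $ i) * (Ls ! k) $ m $ j) * of_real (x i + x j) / 2"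
proof -
  have r: "(A ** diag_mat x) $ a $ b = A $ a $ b * of_real (x b)" for A :: "complex^'a^'a" and a b
    by (simp add: matrix_mult_nth if_distrib[of "\<lambda>x. _ * x"] cong: if_cong)
  have l: "(diag_mat x ** A) $ a $ b = of_real (x a) * A $ a $ b" for A :: "complex^'a^'a" and a b
    by (simp add: matrix_mult_nth if_distrib[of "\<lambda>x. x * _"] cong: if_cong)
  have d: "dissipator K (diag_mat x) $ i $ j = (\<Sum>l\<in>UNIV. K $ i $ l * of_real (x l) * cnj (K $ j $ l))
      - (\<Sum>m\<in>UNIV. cnj (K $ m $ i) * K $ m $ j) * of_real (x i + x j) / 2" for K
    unfolding dissipator_def
    by (simp add: r l, simp add: matrix_mult_nth[of "K ** diag_mat x"] r matrix_mult_nth[of "adj K"] algebra_simps)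
  have "sum_list (map (\<lambda>K. dissipator K (diag_mat x)) Ls) $ i $ j
    = (\<Sum>k<length Ls. \<Sum>l\<in>UNIV. (Ls ! k) $ i $ l * of_real (x l) * cnj ((Ls ! k) $ j $ l))
     - (\<Sum>k<length Ls. \<Sum>m\<in>UNIV. cnj ((Ls ! k) $ m $ i) * (Ls ! k) $ m $ j) * of_real (x i + x j) / 2"
    by (simp add: sum_list_mat_nth sum_list_sum_nth atLeast0LessThan o_def d sum_subtractf
        sum_distrib_right[of _ _ "_ + _"] sum_divide_distrib)
  then show ?thesis by (simp add: gksl_dissipator r l algebra_simps)
qed

text \<open>By stationarity no jump leaves the indices with positive \<open>x\<close>, nor those
  with negative \<open>x\<close>. Each matrix entry of the equation for the positive part then
  either coincides with that for \<open>x\<close> or has only vanishing terms.\<close>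

lemma gksl_diag_pos_part:
  assumes ker: "gksl H Ls (diag_mat x) = 0"
  shows "gksl H Ls (diag_mat (\<lambda>i. max (x i) 0)) = 0"
proof -
  define N where "N = length Ls"
  define K where "K k = Ls ! k" for k
  define w where "w i l = (\<Sum>k<N. (cmod (K k $ i $ l))\<^sup>2)" for i l
  define y where "y i = max (x i) 0" for i
  note nth = gksl_diag_nth[of H Ls, folded N_def K_def]
  have w0: "0 \<le> w i l" for i l by (simp add: w_def sum_nonneg)
  have wK: "K k $ i $ l = 0" if "w i l = 0" "k < N" for i l k
    using that unfolding w_def by (subst (asm) sum_nonneg_eq_0_iff) auto
  have st: "(\<Sum>l\<in>UNIV. w i l * x l) = (\<Sum>m\<in>UNIV. w m i) * x i" for i
  proof -
    have "0 = gksl H Ls (diag_mat x) $ i $ i" by (simp add: ker)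
    also have "\<dots> = of_real ((\<Sum>l\<in>UNIV. w i l * x l) - (\<Sum>m\<in>UNIV. w m i) * x i)"
    proof -
      have "(\<Sum>k<N. \<Sum>l\<in>UNIV. K k $ i $ l * of_real (x l) * cnj (K k $ i $ l)) = of_real (\<Sum>l\<in>UNIV. w i l * x l)"
        unfolding w_def by (subst sum.swap) (simp add: complex_norm_square sum_distrib_left mult_ac del: of_real_power)
      moreover have "(\<Sum>k<N. \<Sum>m\<in>UNIV. cnj (K k $ m $ i) * K k $ m $ i) = of_real (\<Sum>m\<in>UNIV. w m i)"
        unfolding w_def by (subst sum.swap) (simp add: complex_norm_square mult_ac del: of_real_power)
      ultimately show ?thesis unfolding nth by simp
    qed
    finally show ?thesis by (metis eq_iff_diff_eq_0 of_real_eq_0_iff)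
  qed
  \<comment> \<open>\<open>a\<close> forbids jumps out of the positive indices; \<open>b\<close> is
    the same fact for the negative ones, by passing to \<open>- x\<close>.\<close>
  have a: "K k $ j $ i = 0" if "x i > 0" "\<not> x j > 0" "k < N" for i j k
    using stationary_support_closed[of w x, OF w0 st that(1,2)] wK that(3) by blast
  have b: "K k $ j $ i = 0" if "x i < 0" "\<not> x j < 0" "k < N" for i j k
  proof -
    have "(\<Sum>l\<in>UNIV. w i l * - x l) = (\<Sum>m\<in>UNIV. w m i) * - x i" for i
      using st[of i] by (simp add: sum_negf)
    then show ?thesis
      using stationary_support_closed[of w "\<lambda>i. - x i" i j] w0 wK that by simp
  qed
  have "gksl H Ls (diag_mat y) $ i $ j = 0" for i j
  proof -
    let ?G = "\<Sum>k<N. \<Sum>m\<in>UNIV. cnj (K k $ m $ i) * K k $ m $ j"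
    let ?T = "\<lambda>x. \<Sum>k<N. \<Sum>l\<in>UNIV. K k $ i $ l * complex_of_real (x l) * cnj (K k $ j $ l)"
    have x0: "- \<i> * H $ i $ j * of_real (x j - x i) + ?T x - ?G * of_real (x i + x j) / 2 = 0"
      using nth[of x i j] by (simp add: ker)
    \<comment> \<open>Only indices \<open>l\<close> with positive \<open>x l\<close> contribute, and
      from these both \<open>i\<close> and \<open>j\<close> can be reached only if they are positive
      as well.\<close>
    have yT: "?T y = 0" if "\<not> (x i > 0 \<and> x j > 0)"
    proof (intro sum.neutral ballI)
      fix k l assume "k \<in> {..<N}"
      then show "K k $ i $ l * complex_of_real (y l) * cnj (K k $ j $ l) = 0"
        using that a[of l i k] a[of l j k] by (cases "x l > 0") (auto simp: y_def)
    qed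
    have xT: "?T x = 0" if "(x i > 0 \<and> \<not> x j > 0) \<or> (x j > 0 \<and> \<not> x i > 0)"
    proof (intro sum.neutral ballI)
      fix k l assume k: "k \<in> {..<N}"
      consider "x l > 0" | "x l < 0" | "x l = 0" by linarith
      then show "K k $ i $ l * complex_of_real (x l) * cnj (K k $ j $ l) = 0"
        using that k a[of l i k] a[of l j k] b[of l i k] b[of l j k] by cases auto
    qed
    \<comment> \<open>A common target \<open>m\<close> of \<open>i\<close> and \<open>j\<close>
      would have to be both positive and negative.\<close>
    have G: "?G = 0" if "(x i > 0 \<and> x j < 0) \<or> (x j > 0 \<and> x i < 0)"
    proof (intro sum.neutral ballI)
      fix k m assume k: "k \<in> {..<N}"
      show "cnj (K k $ m $ i) * K k $ m $ j = 0"
        using that k a[of i m k] a[of j m k] b[of i m k] b[of j m k] by (cases "x m > 0") auto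
    qed
    \<comment> \<open>With the jump and anticommutator terms gone, the equation for \<open>x\<close>
      leaves \<open>H $ i $ j\<close> times a nonzero difference.\<close>
    have H: "H $ i $ j = 0" if "(x i > 0 \<and> x j < 0) \<or> (x j > 0 \<and> x i < 0)"
    proof -
      have "x j - x i \<noteq> 0" using that by linarith
      moreover have "\<i> * H $ i $ j * of_real (x j - x i) = 0"
        using x0 that unfolding G[OF that] by (subst (asm) xT) (auto simp del: of_real_diff)
      ultimately show ?thesis by (simp del: of_real_diff)
    qed
    consider (pp) "x i > 0" "x j > 0" | (nn) "\<not> x i > 0" "\<not> x j > 0"
      | (z) "(x i > 0 \<and> x j = 0) \<or> (x j > 0 \<and> x i = 0)"
      | (pn) "(x i > 0 \<and> x j < 0) \<or> (x j > 0 \<and> x i < 0)"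
      using less_linear[of "x i" 0] less_linear[of "x j" 0] by blast
    then show ?thesis
    proof cases
      case pp
      have "?T y = ?T x"
      proof (intro sum.cong refl)
        fix k l assume k: "k \<in> {..<N}"
        show "K k $ i $ l * complex_of_real (y l) * cnj (K k $ j $ l) = K k $ i $ l * complex_of_real (x l) * cnj (K k $ j $ l)"
          using pp k b[of l i k] by (cases "x l < 0") (auto simp: y_def)
      qed
      then show ?thesis using x0 pp unfolding nth by (simp add: y_def)
    next
      case nn
      then show ?thesis using yT unfolding nth by (simp add: y_def)
    next
      case z
      then have "?T y = 0" "?T x = 0" "y i = x i" "y j = x j" using yT xT by (auto simp: y_def)
      then show ?thesis using x0 unfolding nth by simp
    next
      case pn
      then show ?thesis unfolding nth G[OF pn] H[OF pn] using yT by auto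
    qed
  qed
  then show ?thesis unfolding y_def by (simp add: vec_eq_iff)
qed

section \<open>From a unique steady state to a one-dimensional kernel\<close>

lemma psd_mtrace_real: "psd A \<Longrightarrow> mtrace A = of_real (Re (mtrace A))"
  using mtrace_adj[of A] by (simp add: psd_def hermitian_def complex_eq_iff)

lemma steady_psd:
  fixes L :: "complex^'n^'n \<Rightarrow> complex^'n^'n"
  assumes sc: "\<And>c X. L (cscale c X) = cscale c (L X)"
    and uniq: "{\<rho>. density \<rho> \<and> L \<rho> = 0} = {\<sigma>}"
    and A: "psd A" "L A = 0"
  shows "A = cscale (mtrace A) \<sigma>"
proof -
  define t where "t = Re (mtrace A)"
  have mt: "mtrace A = of_real t" using psd_mtrace_real[OF A(1)] by (simp add: t_def)
  have t: "norm A \<le> t" using trace_norm_psd[OF A(1)] norm_le_trace_norm[of A] by (simp add: t_def)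
  show ?thesis
  proof (cases "t = 0")
    case True
    then show ?thesis using t mt by simp
  next
    case False
    then have tp: "t > 0" using t norm_ge_zero[of A] by linarith
    have "psd ((1 / t) *\<^sub>R A)" using A(1) tp by (intro psd_scaleR) auto
    moreover have "mtrace ((1 / t) *\<^sub>R A) = 1" using tp by (simp add: mtrace_scaleR mt)
    moreover have "L ((1 / t) *\<^sub>R A) = 0" by (simp add: scaleR_cscale sc A(2))
    ultimately have "(1 / t) *\<^sub>R A \<in> {\<rho>. density \<rho> \<and> L \<rho> = 0}" by (simp add: density_def)
    then have "\<sigma> = (1 / t) *\<^sub>R A" unfolding uniq by simp
    then show ?thesis using tp by (simp add: mt flip: scaleR_cscale)
  qed
qed

text \<open>Jordan decomposition: the positive and negative parts of a Hermitian kernel element lie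
  in the kernel by \<open>gksl_diag_pos_part\<close>, and \<open>steady_psd\<close> makes each a
  multiple of \<sigma>.\<close>

lemma steady_hermitian:
  fixes H :: "complex^'n^'n"
  assumes uniq: "{\<rho>. density \<rho> \<and> gksl H Ls \<rho> = 0} = {\<sigma>}"
    and X: "hermitian X" "gksl H Ls X = 0"
  shows "X = cscale (mtrace X) \<sigma>"
proof -
  obtain U :: "complex^'n^'n" and d where U: "adj U ** U = mat 1" "U ** adj U = mat 1"
    "X = U ** diag_mat d ** adj U"
    using hermitian_diagonalisation[OF X(1)] by blast
  define L' where "L' = gksl (adj U ** H ** U) (map (\<lambda>K. adj U ** K ** U) Ls)"
  have conj: "gksl H Ls (U ** Y ** adj U) = U ** L' Y ** adj U" for Y
    unfolding L'_def by (rule gksl_unitary_conj[OF U(1,2)])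
  have "U ** L' (diag_mat d) ** adj U = 0" using X(2) U(3) conj by simp
  then have "adj U ** (U ** L' (diag_mat d) ** adj U) ** U = 0"
    by (simp add: vec_eq_iff matrix_mult_nth)
  moreover have "adj U ** (U ** L' (diag_mat d) ** adj U) ** U = (adj U ** U) ** L' (diag_mat d) ** (adj U ** U)"
    by (simp add: matrix_mul_assoc)
  ultimately have d0: "L' (diag_mat d) = 0" using U(1) by simp
  \<comment> \<open>The negative part of \<open>d\<close> is the positive part of
    \<open>- d\<close>, so one argument serves both.\<close>
  have "diag_mat (\<lambda>i. - d i) = cscale (-1) (diag_mat d)" by (simp add: vec_eq_iff)
  then have d1: "L' (diag_mat (\<lambda>i. - d i)) = 0" using d0 unfolding L'_def by (simp add: gksl_cscale)
  have part: "U ** diag_mat (\<lambda>i. max (f i) 0) ** adj U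
      = cscale (mtrace (U ** diag_mat (\<lambda>i. max (f i) 0) ** adj U)) \<sigma>"
    if "L' (diag_mat f) = 0" for f
  proof (rule steady_psd[OF gksl_cscale uniq])
    show "psd (U ** diag_mat (\<lambda>i. max (f i) 0) ** adj U)" by (intro psd_conj psd_diag_mat) simp
    have "L' (diag_mat (\<lambda>i. max (f i) 0)) = 0"
      using that unfolding L'_def by (rule gksl_diag_pos_part)
    then show "gksl H Ls (U ** diag_mat (\<lambda>i. max (f i) 0) ** adj U) = 0"
      by (simp add: conj)
  qed
  define A B where "A = U ** diag_mat (\<lambda>i. max (d i) 0) ** adj U"
    and "B = U ** diag_mat (\<lambda>i. max (- d i) 0) ** adj U"
  have "diag_mat d = diag_mat (\<lambda>i. max (d i) 0) - diag_mat (\<lambda>i. max (- d i) 0)"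
    by (simp add: vec_eq_iff max_def)
  then have XAB: "X = A - B"
    unfolding U(3) A_def B_def by (simp add: matrix_mult_diff_left matrix_mult_diff_right)
  have "A = cscale (mtrace A) \<sigma>" "B = cscale (mtrace B) \<sigma>"
    using part[OF d0] part[OF d1] unfolding A_def B_def by blast+
  then have "X = cscale (mtrace A) \<sigma> - cscale (mtrace B) \<sigma>" using XAB by simp
  also have "\<dots> = cscale (mtrace X) \<sigma>"
    unfolding XAB mtrace_diff by (simp add: vec_eq_iff algebra_simps)
  finally show ?thesis .
qed

text \<open>Uniqueness among densities extends to the whole complex kernel, which is closed under
  \<open>adj\<close>: split \<open>X\<close> into its Hermitian and anti-Hermitian parts.\<close>

lemma steady_unique:
  fixes H :: "complex^'n^'n"
  assumes H: "hermitian H" and uniq: "{\<rho>. density \<rho> \<and> gksl H Ls \<rho> = 0} = {\<sigma>}"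
    and X: "gksl H Ls X = 0"
  shows "X = cscale (mtrace X) \<sigma>"
proof -
  define A B where "A = X + adj X" and "B = cscale \<i> (X + cscale (-1) (adj X))"
  have adjX: "gksl H Ls (adj X) = 0" using gksl_adj[OF H, of Ls X] X by (simp add: vec_eq_iff)
  have "A = cscale (mtrace A) \<sigma>"
    by (rule steady_hermitian[OF uniq])
       (simp_all add: A_def hermitian_def adj_add gksl_add X adjX add.commute)
  moreover have "B = cscale (mtrace B) \<sigma>"
    by (rule steady_hermitian[OF uniq])
       (simp_all add: B_def hermitian_def gksl_add gksl_cscale X adjX, simp add: vec_eq_iff algebra_simps)
  moreover have "X = cscale (1/2) A + cscale (-\<i>/2) B"
    by (simp add: A_def B_def vec_eq_iff algebra_simps)
  ultimately have "X = cscale (1/2) (cscale (mtrace A) \<sigma>) + cscale (-\<i>/2) (cscale (mtrace B) \<sigma>)" by metis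
  also have "\<dots> = cscale (mtrace (cscale (1/2) A + cscale (-\<i>/2) B)) \<sigma>"
    by (simp add: mtrace_add mtrace_cscale vec_eq_iff algebra_simps)
  finally show ?thesis using \<open>X = cscale (1/2) A + cscale (-\<i>/2) B\<close> by simp
qed

section \<open>The projection onto the steady state as a polynomial in the generator\<close>

text \<open>\<open>dependent\<close> speaks of sets, so a repeated value in the sequence is a
  separate case, with coefficients 1 and -1.\<close>

lemma sequence_linear_dependence:
  fixes M :: "nat \<Rightarrow> 'a::euclidean_space"
  obtains N b where "\<exists>k\<le>N. b k \<noteq> 0" "(\<Sum>k\<le>N. b k *\<^sub>R M k) = 0"
proof (cases "inj_on M {..DIM('a)}")
  case True
  have "card (M ` {..DIM('a)}) = Suc DIM('a)" using True by (simp add: card_image)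
  then have "dependent (M ` {..DIM('a)})" using independent_bound[of "M ` {..DIM('a)}"] by auto
  then obtain u where u: "\<exists>v\<in>M ` {..DIM('a)}. u v \<noteq> 0" "(\<Sum>v\<in>M ` {..DIM('a)}. u v *\<^sub>R v) = 0"
    using dependent_finite[of "M ` {..DIM('a)}"] by auto
  show thesis
    by (rule that[of "DIM('a)" "\<lambda>k. u (M k)"]) (use u True in \<open>auto simp: sum.reindex\<close>)
next
  case False
  then obtain i j where ij: "i \<le> DIM('a)" "j \<le> DIM('a)" "M i = M j" "i \<noteq> j" by (auto simp: inj_on_def)
  have "(\<Sum>k\<le>DIM('a). ((if k = i then 1 else 0) - (if k = j then 1 else 0)) *\<^sub>R M k) = 0"
    using ij by (simp add: scaleR_diff_left sum_subtractf if_distrib[of "\<lambda>c. c *\<^sub>R _"] cong: if_cong)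
  then show thesis
    using ij by (intro that[of "DIM('a)" "\<lambda>k. (if k = i then 1 else 0) - (if k = j then 1 else 0)"]) auto
qed

lemma linear_funpow: "linear (L :: 'a::real_vector \<Rightarrow> 'a) \<Longrightarrow> linear (L ^^ k)"
  by (induction k) (auto simp: linear_compose linear_id)

lemma choi_nth: "choi N $ x $ y = N (ketbra (fst x) (fst y)) $ snd x $ snd y"
  by (simp add: choi_def)

lemma choi_apply:
  assumes lin: "linear N" and sc: "\<And>c X. N (cscale c X) = cscale c (N X)"
  shows "N X $ a $ b = (\<Sum>i\<in>UNIV. \<Sum>j\<in>UNIV. X $ i $ j * choi N $ (i, a) $ (j, b))"
proof -
  have "X = (\<Sum>i\<in>UNIV. \<Sum>j\<in>UNIV. cscale (X $ i $ j) (ketbra i j))"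
  proof -
    have "(\<Sum>i\<in>UNIV. \<Sum>j\<in>UNIV. cscale (X $ i $ j) (ketbra i j)) $ p $ q = X $ p $ q" for p q
    proof -
      have "(\<Sum>j\<in>UNIV. cscale (X $ i $ j) (ketbra i j) $ p $ q) = (if i = p then X $ p $ q else 0)" for i
        by (cases "i = p") (simp_all add: if_distrib[of "\<lambda>x. _ * x"] cong: if_cong)
      then show ?thesis by simp
    qed
    then show ?thesis by (simp add: vec_eq_iff)
  qed
  then have "N X = N (\<Sum>i\<in>UNIV. \<Sum>j\<in>UNIV. cscale (X $ i $ j) (ketbra i j))" by simp
  also have "\<dots> = (\<Sum>i\<in>UNIV. \<Sum>j\<in>UNIV. cscale (X $ i $ j) (N (ketbra i j)))"
    by (simp add: linear_sum[OF lin] sc)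
  finally show ?thesis by (simp add: choi_nth)
qed

text \<open>A polynomial relation for \<open>L\<close> factors as L^m q(L) = 0 with q(0) = 1. The
  kernels of the powers of \<open>L\<close> do not grow, so q(L) maps into the kernel of
  \<open>L\<close>, and it preserves the trace. Hence q(L) X is tr X times \<sigma>.\<close>

lemma steady_projection_polynomial:
  fixes L :: "complex^'n^'n \<Rightarrow> complex^'n^'n"
  assumes lin: "linear L" and sc: "\<And>c X. L (cscale c X) = cscale c (L X)"
    and tr: "\<And>X. mtrace (L X) = 0"
    and ker: "\<And>X. L X = 0 \<Longrightarrow> X = cscale (mtrace X) \<sigma>"
  obtains c n where "\<And>X. (\<Sum>k\<le>n. c k *\<^sub>R (L ^^ k) X) = cscale (mtrace X) \<sigma>"
proof -
  note linp = linear_funpow[OF lin]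
  have scp: "(L ^^ k) (cscale c X) = cscale c ((L ^^ k) X)" for k c X
    by (induction k) (simp_all add: sc)
  \<comment> \<open>Choi operators turn the powers of \<open>L\<close> into vectors of a
    finite-dimensional space; \<open>choi_apply\<close> carries the relation back to the
    maps.\<close>
  obtain N b where b: "\<exists>k\<le>N. b k \<noteq> 0" "(\<Sum>k\<le>N. b k *\<^sub>R choi (L ^^ k)) = 0"
    by (rule sequence_linear_dependence)
  have rel: "(\<Sum>k\<le>N. b k *\<^sub>R (L ^^ k) X) = 0" for X
  proof -
    have "(\<Sum>k\<le>N. b k *\<^sub>R (L ^^ k) X) $ p $ q = 0" for p q
    proof -
      have "(\<Sum>k\<le>N. b k *\<^sub>R (L ^^ k) X) $ p $ q = (\<Sum>k\<le>N. of_real (b k) * (L ^^ k) X $ p $ q)"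
        by (simp only: sum_component scaleR_mat_nth)
      also have "\<dots> = (\<Sum>k\<le>N. \<Sum>i\<in>UNIV. \<Sum>j\<in>UNIV. X $ i $ j * (of_real (b k) * choi (L ^^ k) $ (i, p) $ (j, q)))"
        by (simp add: choi_apply[OF linp scp] sum_distrib_left algebra_simps)
      also have "\<dots> = (\<Sum>i\<in>UNIV. \<Sum>j\<in>UNIV. X $ i $ j * (\<Sum>k\<le>N. of_real (b k) * choi (L ^^ k) $ (i, p) $ (j, q)))"
        unfolding sum_distrib_left by (subst sum.swap, rule sum.cong[OF refl], rule sum.swap)
      also have "\<dots> = (\<Sum>i\<in>UNIV. \<Sum>j\<in>UNIV. X $ i $ j * (\<Sum>k\<le>N. b k *\<^sub>R choi (L ^^ k)) $ (i, p) $ (j, q))"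
        by (simp only: sum_component scaleR_mat_nth)
      also have "\<dots> = 0" by (simp add: b(2))
      finally show ?thesis .
    qed
    then show ?thesis by (simp add: vec_eq_iff)
  qed
  \<comment> \<open>Splitting off the lowest power with nonzero coefficient and dividing by
    \<open>b m\<close> gives \<open>c 0 = 1\<close>.\<close>
  define m where "m = (LEAST k. b k \<noteq> 0)"
  have m: "b m \<noteq> 0" "m \<le> N" and below: "\<And>k. k < m \<Longrightarrow> b k = 0"
  proof -
    from b(1) obtain k where k: "k \<le> N" "b k \<noteq> 0" by blast
    show "b m \<noteq> 0" unfolding m_def by (rule LeastI[of _ k]) (rule k)
    show "m \<le> N" unfolding m_def by (rule order_trans[OF Least_le k(1)]) (rule k)
    show "b k = 0" if "k < m" for k using not_less_Least[of k "\<lambda>k. b k \<noteq> 0"] that by (simp add: m_def)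
  qed
  define c where "c k = b (k + m) / b m" for k
  define q where "q X = (\<Sum>k\<le>N - m. c k *\<^sub>R (L ^^ k) X)" for X
  have Lm: "(L ^^ m) (q X) = 0" for X
  proof -
    have "(L ^^ m) ((L ^^ k) X) = (L ^^ (k + m)) X" for k
      using funpow_add[of m k L] by (simp add: add.commute)
    then have "(L ^^ m) (q X) = (\<Sum>k\<le>N - m. c k *\<^sub>R (L ^^ (k + m)) X)"
      by (simp add: q_def linear_sum[OF linp] linear_scale[OF linp])
    also have "\<dots> = (1 / b m) *\<^sub>R (\<Sum>k\<le>N - m. b (k + m) *\<^sub>R (L ^^ (k + m)) X)"
      by (simp add: c_def scaleR_sum_right)
    also have "(\<Sum>k\<le>N - m. b (k + m) *\<^sub>R (L ^^ (k + m)) X) = (\<Sum>k\<in>{m..N}. b k *\<^sub>R (L ^^ k) X)"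
      using m(2) by (intro sum.reindex_bij_witness[of _ "\<lambda>k. k - m" "\<lambda>k. k + m"]) auto
    also have "\<dots> = (\<Sum>k\<le>N. b k *\<^sub>R (L ^^ k) X)"
      by (rule sum.mono_neutral_left) (auto simp: below)
    also have "\<dots> = 0" by (rule rel)
    finally show ?thesis by simp
  qed
  \<comment> \<open>A kernel element in the range of \<open>L\<close> is its trace times \<sigma>
    and also traceless, hence 0. This lowers the exponent step by step.\<close>
  have kerp: "L Y = 0" if "(L ^^ k) Y = 0" for k Y
    using that
  proof (induction k)
    case 0
    then show ?case using linear_0[OF lin] by simp
  next
    case (Suc k)
    show ?case
    proof (cases k)
      case 0
      then show ?thesis using Suc.prems by simp
    next
      case (Suc j)
      have "L ((L ^^ k) Y) = 0" using Suc.prems by simp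
      then have "(L ^^ k) Y = cscale (mtrace ((L ^^ k) Y)) \<sigma>" by (rule ker)
      moreover have "mtrace ((L ^^ k) Y) = 0" by (simp add: Suc tr)
      ultimately have "(L ^^ k) Y = 0" by simp
      then show ?thesis by (rule Suc.IH)
    qed
  qed
  have "q X = cscale (mtrace X) \<sigma>" for X
  proof -
    have "q X = cscale (mtrace (q X)) \<sigma>" by (rule ker[OF kerp[OF Lm]])
    \<comment> \<open>All positive powers of \<open>L\<close> are traceless, so only the constant
      term, with \<open>c 0 = 1\<close>, counts.\<close>
    moreover have "mtrace (q X) = mtrace X"
    proof -
      have trp: "mtrace ((L ^^ k) X) = (if k = 0 then mtrace X else 0)" for k
        by (cases k) (simp_all add: tr)
      have "mtrace (\<Sum>k\<in>I. f k) = (\<Sum>k\<in>I. mtrace (f k))" for I and f :: "nat \<Rightarrow> complex^'n^'n"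
        unfolding mtrace_def by (simp, rule sum.swap)
      then have "mtrace (q X) = (\<Sum>k\<le>N - m. of_real (c k) * (if k = 0 then mtrace X else 0))"
        by (simp add: q_def mtrace_scaleR trp)
      also have "\<dots> = mtrace X" using m(1) by (simp add: c_def if_distrib[of "\<lambda>x. _ * x"] cong: if_cong)
      finally show ?thesis .
    qed
    ultimately show ?thesis by simp
  qed
  then show thesis using that[of c "N - m"] by (simp add: q_def)
qed

section \<open>Taylor coefficients of the programming constraint\<close>

text \<open>Identity theorem: the zeros in the interval accumulate at 0, while those of a nonzero
  power series are isolated.\<close>

lemma real_powser_zero_coeff:
  fixes a :: "nat \<Rightarrow> real"
  assumes T: "T > 0" and s: "\<And>x. summable (\<lambda>k. a k * x ^ k)"
    and z: "\<And>t. t \<in> {0..T} \<Longrightarrow> (\<lambda>k. a k * t ^ k) sums 0"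
  shows "a k = 0"
proof (rule ccontr)
  assume k: "a k \<noteq> 0"
  \<comment> \<open>The point 0 disposes of the constant coefficient, leaving a nonzero coefficient
    of positive index as \<open>powser_0_nonzero\<close> demands.\<close>
  have "(\<lambda>k. a k * 0 ^ k) sums 0" using z[of 0] T by simp
  then have "a 0 = 0" using sums_unique2[OF powser_sums_zero[of a]] by blast
  then have k0: "k > 0" using k by (cases k) auto
  define f where "f x = (\<Sum>k. a k * x ^ k)" for x
  have f: "(\<lambda>k. a k * x ^ k) sums f x" for x using s by (simp add: f_def summable_sums)
  have f0: "f t = 0" if "t \<in> {0..T}" for t using sums_unique2[OF f z[OF that]] .
  obtain r where r: "r > 0" "\<And>x. x \<in> cball 0 r - {0} \<Longrightarrow> f x \<noteq> 0"
  proof (rule powser_0_nonzero[of 1 0 a f k])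
    show "(\<lambda>n. a n * (x - 0) ^ n) sums f x" for x using f[of x] by simp
    show "f 0 = 0" using f0[of 0] T by simp
  qed (use k k0 in auto)
  have "min r T \<in> cball 0 r - {0}" using r T by (auto simp: min_def)
  then show False using r(2) f0[of "min r T"] r(1) T by auto
qed

lemma norm_funpow_le:
  fixes L :: "'a::real_normed_vector \<Rightarrow> 'a"
  assumes B: "\<And>X. norm (L X) \<le> B * norm X" and "B \<ge> 0"
  shows "norm ((L ^^ k) X) \<le> B ^ k * norm X"
proof (induction k)
  case (Suc k)
  have "norm ((L ^^ Suc k) X) \<le> B * norm ((L ^^ k) X)" by (simp add: B)
  also have "\<dots> \<le> B * (B ^ k * norm X)" using Suc assms(2) by (rule mult_left_mono)
  finally show ?case by (simp add: mult.assoc)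
qed simp

text \<open>\<open>semigroup\<close> is defined by a \<open>suminf\<close>, which carries
  information only once convergence is known; the exponential series of an operator bound dominates
  it.\<close>

lemma semigroup_sums:
  fixes L :: "complex^'n^'n \<Rightarrow> complex^'n^'n"
  assumes "linear L"
  shows "(\<lambda>k. (t ^ k / fact k) *\<^sub>R (L ^^ k) X) sums semigroup L t X"
  unfolding semigroup_def
proof (rule summable_sums)
  obtain B where B: "B > 0" "\<And>X. norm (L X) \<le> B * norm X"
    using linear_bounded_pos[OF assms] by blast
  have "summable (\<lambda>k. norm X * ((\<bar>t\<bar> * B) ^ k / fact k))"
    using summable_exp[of "\<bar>t\<bar> * B"] by (intro summable_mult) (simp add: field_simps)
  then show "summable (\<lambda>k. (t ^ k / fact k) *\<^sub>R (L ^^ k) X)"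
  proof (rule summable_comparison_test[rotated], intro exI allI impI)
    fix k
    have "norm ((t ^ k / fact k) *\<^sub>R (L ^^ k) X) = \<bar>t\<bar> ^ k / fact k * norm ((L ^^ k) X)"
      by (simp add: power_abs)
    also have "\<dots> \<le> \<bar>t\<bar> ^ k / fact k * (B ^ k * norm X)"
      using norm_funpow_le[of L B k X] B by (intro mult_left_mono) auto
    finally show "norm ((t ^ k / fact k) *\<^sub>R (L ^^ k) X) \<le> norm X * ((\<bar>t\<bar> * B) ^ k / fact k)"
      by (simp add: power_mult_distrib field_simps)
  qed
qed

lemma choi_semigroup_sums:
  fixes L :: "complex^'n^'n \<Rightarrow> complex^'n^'n"
  assumes "linear L"
  shows "(\<lambda>k. (t ^ k / fact k) *\<^sub>R choi (L ^^ k)) sums choi (semigroup L t)"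
proof -
  have "(\<lambda>k. ((t ^ k / fact k) *\<^sub>R choi (L ^^ k)) $ x $ y) sums (choi (semigroup L t) $ x $ y)" for x y
    using bounded_linear.sums[OF bounded_linear_vec_nth[of "snd y"] bounded_linear.sums[OF bounded_linear_vec_nth[of "snd x"]
        semigroup_sums[OF assms, of t "ketbra (fst x) (fst y)"]]]
    by (simp add: choi_nth)
  then show ?thesis unfolding sums_def by (intro vec_tendstoI) (simp add: sum_component)
qed

text \<open>Comparison of Taylor coefficients at 0. The right side does not mention
  \<open>T\<close>, so every time interval of positive length imposes the same constraint.\<close>

lemma program_constraint_iff:
  fixes L :: "complex^'n^'n \<Rightarrow> complex^'n^'n"
    and P :: "complex^('n \<times> ('n \<times> 'n))^('n \<times> ('n \<times> 'n)) \<Rightarrow> complex^'n^'n"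
  assumes lin: "linear L" and P: "linear P" and T: "T > 0"
  shows "(\<forall>t\<in>{0..T}. \<forall>X. P (tensor X (choi_state L t)) = semigroup L t X)
     \<longleftrightarrow> (\<forall>k X. P (tensor X (cscale (1 / of_nat CARD('n)) (choi (L ^^ k)))) = (L ^^ k) X)"
    (is "?A \<longleftrightarrow> ?B")
proof -
  define G where "G X Y = P (tensor X (cscale (1 / of_nat CARD('n)) Y))" for X :: "complex^'n^'n" and Y
  have "linear (\<lambda>Y. G X Y)" for X
  proof -
    have "linear (\<lambda>Y. tensor X (cscale (1 / of_nat CARD('n)) Y))"
      by (intro linearI) (simp_all add: vec_eq_iff algebra_simps)
    from linear_compose[OF this P] show ?thesis by (simp add: G_def o_def)
  qed
  then have "bounded_linear (\<lambda>Y. G X Y)" for X by (simp add: linear_conv_bounded_linear)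
  from bounded_linear.sums[OF this choi_semigroup_sums[OF lin]]
  have "(\<lambda>k. G X ((t ^ k / fact k) *\<^sub>R choi (L ^^ k))) sums G X (choi (semigroup L t))" for X t .
  moreover have "G X (r *\<^sub>R Y) = r *\<^sub>R G X Y" for X r Y
    using linear_scale[OF \<open>linear (\<lambda>Y. G X Y)\<close>] by simp
  ultimately have Gs: "(\<lambda>k. (t ^ k / fact k) *\<^sub>R G X (choi (L ^^ k))) sums P (tensor X (choi_state L t))" for X t
    by (simp add: G_def choi_state_def)
  note Ls = semigroup_sums[OF lin]
  show ?thesis
  proof
    assume B: ?B
    show ?A
    proof (intro ballI allI)
      fix t X
      have "(\<lambda>k. (t ^ k / fact k) *\<^sub>R (L ^^ k) X) sums P (tensor X (choi_state L t))"
        using Gs[of t X] B by (simp add: G_def)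
      then show "P (tensor X (choi_state L t)) = semigroup L t X"
        using Ls sums_unique2 by blast
    qed
  next
    assume A: ?A
    have "G X (choi (L ^^ k)) = (L ^^ k) X" for k X
    proof -
      define c where "c k = G X (choi (L ^^ k)) - (L ^^ k) X" for k
      \<comment> \<open>Pairing with the very coefficient under study gives a real power series; the
        vanishing of its \<open>k\<close>-th coefficient makes the norm of \<open>c k\<close>
        zero.\<close>
      define e where "e = c k"
      have cs: "(\<lambda>k. (c k \<bullet> e / fact k) * t ^ k) sums ((P (tensor X (choi_state L t)) - semigroup L t X) \<bullet> e)" for t
        using bounded_linear.sums[OF bounded_linear_inner_left[of e] sums_diff[OF Gs[of t X] Ls[of t X]]]
        by (simp add: c_def inner_diff_left algebra_simps diff_divide_distrib)
      have "c k \<bullet> e / fact k = 0"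
      proof (rule real_powser_zero_coeff[OF T])
        show "summable (\<lambda>k. (c k \<bullet> e / fact k) * x ^ k)" for x using cs sums_summable by blast
        show "(\<lambda>k. (c k \<bullet> e / fact k) * t ^ k) sums 0" if "t \<in> {0..T}" for t
          using cs[of t] A that by simp
      qed
      then have "c k = 0" by (simp add: e_def)
      then show ?thesis by (simp add: c_def)
    qed
    then show ?B by (simp add: G_def)
  qed
qed

section \<open>The cost of Choi-state programs\<close>

text \<open>The cost is constant for \<open>T > 0\<close>, so the limit in \<open>prog_cost\<close>
  is that constant.\<close>

lemma gamma_choi_eq:
  fixes L :: "complex^'n^'n \<Rightarrow> complex^'n^'n"
  assumes "linear L"
  defines "S \<equiv> {P :: complex^('n \<times> ('n \<times> 'n))^('n \<times> ('n \<times> 'n)) \<Rightarrow> complex^'n^'n. hp_tp_linear P \<and>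
      (\<forall>k X. P (tensor X (cscale (1 / of_nat CARD('n)) (choi (L ^^ k)))) = (L ^^ k) X)}"
  shows "gamma L = (if S = {} then \<infinity> else ereal (log 2 (INF P\<in>S. diamond_norm P)))"
proof -
  have "prog_cost_T (choi_state L) L T = (if S = {} then \<infinity> else ereal (log 2 (INF P\<in>S. diamond_norm P)))"
    if "T > 0" for T
  proof -
    have "{P :: complex^('n \<times> ('n \<times> 'n))^('n \<times> ('n \<times> 'n)) \<Rightarrow> complex^'n^'n. hp_tp_linear P \<and>
        (\<forall>t\<in>{0..T}. \<forall>X. P (tensor X (choi_state L t)) = semigroup L t X)} = S"
      unfolding S_def using program_constraint_iff[OF assms(1) hp_tp_linear_linear that] by blast
    then show ?thesis unfolding prog_cost_T_def Let_def by simp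
  qed
  then have "eventually (\<lambda>T. (if S = {} then \<infinity> else ereal (log 2 (INF P\<in>S. diamond_norm P)))
      = prog_cost_T (choi_state L) L T) at_top"
    by (intro eventually_mono[OF eventually_gt_at_top[of 0]]) simp
  then have "(prog_cost_T (choi_state L) L \<longlongrightarrow> (if S = {} then \<infinity> else ereal (log 2 (INF P\<in>S. diamond_norm P)))) at_top"
    by (rule Lim_transform_eventually[OF tendsto_const])
  then show ?thesis unfolding gamma_def prog_cost_def by (intro tendsto_Lim) auto
qed

section \<open>The two program operators and their overlap\<close>

definition max_ent :: "complex^('n::finite \<times> 'n)" where
  "max_ent = (\<chi> x. if fst x = snd x then of_real (1 / sqrt (real CARD('n))) else 0)"

lemma outer_max_ent: "outer (max_ent :: complex^('n::finite \<times> 'n)) = cscale (1 / of_nat CARD('n)) (choi (\<lambda>X. X))"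
proof -
  have "1 / sqrt (real CARD('n)) * (1 / sqrt (real CARD('n))) = 1 / real CARD('n)" by simp
  then have "complex_of_real (1 / sqrt (real CARD('n))) * complex_of_real (1 / sqrt (real CARD('n))) = 1 / of_nat CARD('n)"
    by (simp flip: of_real_mult)
  then show ?thesis by (simp add: vec_eq_iff max_ent_def choi_nth)
qed

lemma norm_max_ent: "norm (max_ent :: complex^('n::finite \<times> 'n)) = 1"
proof -
  have "(norm (max_ent :: complex^('n \<times> 'n)))\<^sup>2 = 1"
    by (simp add: norm_vec_sq sum_UNIV_prod max_ent_def if_distrib[of cmod] if_distrib[of "\<lambda>x. x\<^sup>2"] norm_divide
        power_divide cong: if_cong)
  then show ?thesis by (metis norm_ge_zero power2_eq_1_iff neg_0_le_iff_le not_one_le_zero)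
qed

text \<open>The normalised Choi operator of the map sending X to tr X times \<sigma>.\<close>

definition mixed_tensor :: "complex^'n^'n \<Rightarrow> complex^('n \<times> 'n)^('n \<times> 'n)" where
  "mixed_tensor \<sigma> = cscale (1 / of_nat CARD('n)) (tensor (mat 1) \<sigma>)"

lemma mtrace_mixed_tensor: "mtrace (mixed_tensor \<sigma>) = mtrace \<sigma>"
proof -
  have "mtrace (mat 1 :: complex^'a^'a) = of_nat CARD('a)" by (simp add: mtrace_def mat_def)
  then show ?thesis by (simp add: mixed_tensor_def mtrace_cscale mtrace_tensor)
qed

lemma qform_mixed_tensor:
  fixes \<sigma> :: "complex^'n^'n"
  shows "qform (mixed_tensor \<sigma>) w = (1 / of_nat CARD('n)) * (\<Sum>i\<in>UNIV. qform \<sigma> (\<chi> a. w $ (i, a)))"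
proof -
  have "(tensor (mat 1) \<sigma> *v w) $ (i, a) = (\<sigma> *v (\<chi> a. w $ (i, a))) $ a" for i a
  proof -
    have "(tensor (mat 1) \<sigma> *v w) $ (i, a) = (\<Sum>j\<in>UNIV. if i = j then \<Sum>b\<in>UNIV. \<sigma> $ a $ b * w $ (j, b) else 0)"
      unfolding matrix_vector_nth sum_UNIV_prod by (intro sum.cong refl) (simp add: mat_def)
    then show ?thesis by (simp add: matrix_vector_nth)
  qed
  then have "qform (tensor (mat 1) \<sigma>) w = (\<Sum>i\<in>UNIV. qform \<sigma> (\<chi> a. w $ (i, a)))"
    by (simp add: qform_cip cip_def sum_UNIV_prod)
  then show ?thesis by (simp add: mixed_tensor_def qform_cscale)
qed

lemma psd_mixed_tensor: "psd \<sigma> \<Longrightarrow> psd (mixed_tensor \<sigma>)"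
proof (rule hermitian_qform_psd)
  assume "psd \<sigma>"
  then have "hermitian \<sigma>" and pos: "\<And>v. 0 \<le> Re (qform \<sigma> v)" by (auto simp: psd_def)
  then have "hermitian (tensor (mat 1) \<sigma> :: complex^('a \<times> 'a)^('a \<times> 'a))"
    by (intro hermitian_tensor) (auto simp: hermitian_def vec_eq_iff mat_def)
  then show "hermitian (mixed_tensor \<sigma>)"
    by (simp add: hermitian_def mixed_tensor_def adj_cscale)
  have "(1 / of_nat CARD('a) :: complex) = of_real (1 / real CARD('a))" by simp
  then show "0 \<le> Re (qform (mixed_tensor \<sigma>) v)" for v
    unfolding qform_mixed_tensor by (simp only: Re_complex_of_real times_complex.sel Im_complex_of_real)
       (auto intro!: divide_nonneg_nonneg sum_nonneg pos)
qed

text \<open>Source of the threshold 1/d^2: slice \<open>i\<close> of \<open>max_ent\<close> is the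
  basis vector \<open>i\<close> divided by sqrt d and picks out 1/d of the diagonal entry of
  \<sigma>; the other 1/d is the normalisation of \<open>mixed_tensor\<close>.\<close>

lemma qform_mixed_tensor_max_ent:
  fixes \<sigma> :: "complex^'n^'n"
  shows "qform (mixed_tensor \<sigma>) max_ent = mtrace \<sigma> / (of_nat CARD('n))\<^sup>2"
proof -
  have "1 / sqrt (real CARD('n)) * (1 / sqrt (real CARD('n))) = 1 / real CARD('n)" by simp
  then have *: "complex_of_real (1 / sqrt (real CARD('n))) * complex_of_real (1 / sqrt (real CARD('n))) = 1 / of_nat CARD('n)"
    by (simp flip: of_real_mult)
  have "qform \<sigma> (\<chi> a. if i = a then r else 0) = \<sigma> $ i $ i * (cnj r * r)" for i r
    by (simp add: qform_def if_distrib[of "\<lambda>x. x * _"] if_distrib[of "\<lambda>x. _ * x"] if_distrib[of cnj] cong: if_cong)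
  from this[of _ "complex_of_real (1 / sqrt (real CARD('n)))"]
  have "qform \<sigma> (\<chi> a. max_ent $ (i, a)) = \<sigma> $ i $ i * (1 / of_nat CARD('n))" for i
    unfolding complex_cnj_complex_of_real * by (simp add: max_ent_def)
  then show ?thesis
    by (simp add: qform_mixed_tensor mtrace_def power2_eq_square sum_divide_distrib)
qed

theorem theorem4:
  fixes L :: "complex^'n^'n \<Rightarrow> complex^'n^'n" and \<sigma> :: "complex^'n^'n"
  assumes "is_lindbladian L"
    and "{\<rho>. density \<rho> \<and> L \<rho> = 0} = {\<sigma>}"
    and "\<exists>(lam::real) (v::complex^'n). v \<noteq> 0 \<and> \<sigma> *v v = of_real lam *s v
           \<and> lam < 1 / (real CARD('n))^2"
  shows "gamma L > 0"
proof -
  obtain H Ls where H: "hermitian H" and L: "L = gksl H Ls"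
    using assms(1) unfolding is_lindbladian_def by blast
  have lin: "linear L"
    by (intro linearI) (simp_all add: L gksl_add scaleR_cscale gksl_cscale)
  have \<sigma>: "psd \<sigma>" "mtrace \<sigma> = 1" using assms(2) by (auto simp: density_def)
  have ker: "X = cscale (mtrace X) \<sigma>" if "L X = 0" for X
    using steady_unique[OF H assms(2)[unfolded L]] that[unfolded L] .
  obtain c n where poly: "\<And>X. (\<Sum>k\<le>n. c k *\<^sub>R (L ^^ k) X) = cscale (mtrace X) \<sigma>"
    using steady_projection_polynomial[OF lin gksl_cscale[of H Ls, folded L] mtrace_gksl[of H Ls, folded L] ker]
    by blast
  obtain lam :: real and u :: "complex^'n" where u: "u \<noteq> 0" "\<sigma> *v u = of_real lam *s u"
    and lam: "lam < 1 / (real CARD('n))\<^sup>2" using assms(3) by blast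
  define v where "v = complex_of_real (1 / norm u) *s u"
  have "v = (1 / norm u) *\<^sub>R u" by (simp only: v_def scaleR_smult)
  then have v: "norm v = 1" using u by simp
  have "\<sigma> *v v = of_real lam *s v"
    using u(2) by (simp add: v_def vector_scalar_commute vector_smult_assoc mult.commute)
  then have qv: "qform \<sigma> v = of_real lam"
    using v by (simp add: qform_cip cip_smult_right cip_self)
  let ?d = "1 / of_nat CARD('n) :: complex"
  \<comment> \<open>The polynomial identity on the maps, read off on their Choi operators.\<close>
  have mix: "mixed_tensor \<sigma> = (\<Sum>k\<le>n. c k *\<^sub>R cscale ?d (choi (L ^^ k)))"
  proof -
    have "mixed_tensor \<sigma> $ x $ y = (\<Sum>k\<le>n. c k *\<^sub>R cscale ?d (choi (L ^^ k))) $ x $ y" for x y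
    proof -
      have "(\<Sum>k\<le>n. c k *\<^sub>R cscale ?d (choi (L ^^ k))) $ x $ y
        = ?d * (\<Sum>k\<le>n. c k *\<^sub>R (L ^^ k) (ketbra (fst x) (fst y))) $ snd x $ snd y"
        by (simp add: choi_nth sum_distrib_left)
      also have "\<dots> = ?d * (mtrace (ketbra (fst x) (fst y)) * \<sigma> $ snd x $ snd y)"
        unfolding poly by simp
      also have "mtrace (ketbra (fst x) (fst y)) = (mat 1 :: complex^'n^'n) $ fst x $ fst y"
        by (cases "fst x = fst y") (auto simp: mtrace_def mat_def intro!: sum.neutral)
      finally show ?thesis by (simp add: mixed_tensor_def)
    qed
    then show ?thesis by (simp add: vec_eq_iff)
  qed
  define S where "S = {P :: complex^('n \<times> ('n \<times> 'n))^('n \<times> ('n \<times> 'n)) \<Rightarrow> complex^'n^'n. hp_tp_linear P \<and>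
      (\<forall>k X. P (tensor X (cscale ?d (choi (L ^^ k)))) = (L ^^ k) X)}"
  have s: "qform (mixed_tensor \<sigma>) max_ent = of_real (1 / (real CARD('n))\<^sup>2)"
    by (simp add: qform_mixed_tensor_max_ent \<sigma>)
  have "mtrace (mixed_tensor \<sigma>) = 1" by (simp add: mtrace_mixed_tensor \<sigma>)
  from diamond_norm_gap[OF v norm_max_ent psd_mixed_tensor[OF \<sigma>(1)] this s lam]
  obtain \<epsilon> where \<epsilon>: "\<epsilon> > 0" and gap:
    "\<And>P :: complex^('n \<times> ('n \<times> 'n))^('n \<times> ('n \<times> 'n)) \<Rightarrow> complex^'n^'n. hp_tp_linear P \<Longrightarrow>
      P (tensor (outer v) (outer max_ent)) = outer v \<Longrightarrow>
      Re (qform (P (tensor (outer v) (mixed_tensor \<sigma>))) v) = lam \<Longrightarrow> 1 + \<epsilon> < diamond_norm P"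
    by blast
  have S: "1 + \<epsilon> < diamond_norm P" if "P \<in> S" for P
  proof (rule gap)
    from that have P: "hp_tp_linear P" and prog: "\<And>k X. P (tensor X (cscale ?d (choi (L ^^ k)))) = (L ^^ k) X"
      by (auto simp: S_def)
    note linP = hp_tp_linear_linear[OF P]
    show "hp_tp_linear P" by (rule P)
    \<comment> \<open>The zeroth coefficient of the constraint is the identity channel, whose Choi
      state is maximally entangled.\<close>
    have "L ^^ 0 = (\<lambda>X. X)" by auto
    then show "P (tensor (outer v) (outer max_ent)) = outer v"
      using prog[of "outer v" 0] by (simp add: outer_max_ent)
    have "linear (tensor (outer v) :: complex^('n \<times> 'n)^('n \<times> 'n) \<Rightarrow> _)"
      by (intro linearI) (simp_all add: vec_eq_iff algebra_simps)
    from linear_compose[OF this linP] have l: "linear (\<lambda>Y. P (tensor (outer v) Y))" by (simp add: o_def)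
    \<comment> \<open>Linearity in the program operator extends the constraint from the powers of
      \<open>L\<close> to the polynomial, so the output is \<sigma>, whose expectation in
      \<open>v\<close> is \<open>lam\<close>.\<close>
    have "P (tensor (outer v) (mixed_tensor \<sigma>)) = (\<Sum>k\<le>n. c k *\<^sub>R (L ^^ k) (outer v))"
      unfolding mix linear_sum[OF l] linear_scale[OF l] prog ..
    also have "\<dots> = \<sigma>" unfolding poly using v by (simp add: mtrace_outer)
    finally show "Re (qform (P (tensor (outer v) (mixed_tensor \<sigma>))) v) = lam" using qv by simp
  qed
  \<comment> \<open>The uniform gap keeps the infimum itself above 1, whether or not it is
    attained.\<close>
  have "1 < (INF P\<in>S. diamond_norm P)" if "S \<noteq> {}"
  proof -
    have "1 + \<epsilon> \<le> (INF P\<in>S. diamond_norm P)"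
      using that S by (intro cINF_greatest) (auto simp: less_imp_le)
    then show ?thesis using \<epsilon> by simp
  qed
  \<comment> \<open>Without a feasible \<open>P\<close> the cost is infinite, hence
    positive.\<close>
  then show ?thesis
    unfolding gamma_choi_eq[OF lin] S_def[symmetric] by (cases "S = {}") simp_all
qed

end
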